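(* The maximal entropy efficiency for point-push protocols with two obstacles is realized by the protocol $\alpha_1\alpha_2^{-1}\in\mathcal P_2$, i.e. $\mathrm{Eff}(2)=\mathrm{eff}(\alpha_1\alpha_2^{-1})$, and so has value $$\mathrm{Eff}(2)=\frac{\log(3+2\sqrt2)}{2}=\log(1+\sqrt2).$$
   Context: **Point-push protocols with two obstacles.** Let $D_3$ be the disk with $3$ punctures, arranged left to right; the left-most puncture is the stirrer and the other two are the obstacles. The braid group $B_3$ with standard generators $\sigma_1,\sigma_2$ ($\sigma_i$ switches the $i$th and $(i+1)$st punctures counterclockwise) is identified with the group of isotopy classes of homeomorphisms of $D_3$ (homeomorphisms and isotopies fix the boundary of the disk pointwise); words are read left to right. Put $\alpha_1=\sigma_1^2$ and $\alpha_2=\sigma_1\sigma_2^2\sigma_1^{-1}$. The group $\mathcal P_2$ of point-push protocols with two obstacles is the subgroup of the pure braid group on $3$ strings consisting of the classes that become trivial when the stirrer puncture is filled in; it is free on $\alpha_1,\alpha_2$. **Action on $\pi_1$.** $\pi_1(D_3,Q)$ is free on loops $\delta_1,\delta_2,\delta_3$, where $\delta_1,\delta_2$ go counterclockwise around the first and second obstacle and $\delta_3$ goes clockwise around the stirrer and both obstacles, chosen so that (with representatives fixing $Q$) the action is $\alpha_1(\delta_1)=(\delta_2\delta_3)^{-1}\delta_1(\delta_2\delta_3)$, $\alpha_2(\delta_2)=(\delta_3\delta_1)^{-1}\delta_2(\delta_3\delta_1)$, and $\alpha_j(\delta_i)=\delta_i$ for $i\ne j$. **Efficiency.** For an automorphism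 $a$ of a group with finite generating set $x_1,\dots,x_m$ and word length $\ell$, its entropy is $h(a)=\max_i\limsup_{n\to\infty}\frac1n\log \ell(a^n(x_i))$. For $\chi\in\mathcal P_2$ let $\chi_\sharp$ be the induced automorphism of $\pi_1(D_3,Q)$ and let $L(\chi)$ be the minimal word length of $\chi$ in $\alpha_1^{\pm1},\alpha_2^{\pm1}$. Then $\mathrm{eff}(\chi)=h(\chi_\sharp)/L(\chi)$ (for $\chi\ne 1$) and $\mathrm{Eff}(2)=\sup\{\mathrm{eff}(\chi):\chi\in\mathcal P_2,\ \chi\neq 1\}$. *)

theory Defs
  imports Complex_Main "HOL-Library.Extended_Real" "HOL-Algebra.Group"
    "HOL-Combinatorics.Transposition"
begin

section \<open>Groups given by generators and relations\<close>

text \<open>A letter \<open>(g, True)\<close> stands for the generator \<open>g\<close>, and \<open>(g, False)\<close> for its inverse.\<close>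

type_synonym 'g word = "('g \<times> bool) list"

definition words :: "'g set \<Rightarrow> 'g word set" where
  "words S = {w. fst ` set w \<subseteq> S}"

definition inv_word :: "'g word \<Rightarrow> 'g word" where
  "inv_word w = rev (map (\<lambda>(g, b). (g, \<not> b)) w)"

text \<open>A pair \<open>(l, r)\<close> in \<open>R\<close> is the relation \<open>l = r\<close>.\<close>

inductive word_eq :: "'g set \<Rightarrow> ('g word \<times> 'g word) set \<Rightarrow> 'g word \<Rightarrow> 'g word \<Rightarrow> bool"
  for S R where
  refl: "w \<in> words S \<Longrightarrow> word_eq S R w w"
| sym: "word_eq S R v w \<Longrightarrow> word_eq S R w v"
| trans: "word_eq S R u v \<Longrightarrow> word_eq S R v w \<Longrightarrow> word_eq S R u w"
| cancel: "u \<in> words S \<Longrightarrow> v \<in> words S \<Longrightarrow> g \<in> S \<Longrightarrow>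
    word_eq S R (u @ [(g, b), (g, \<not> b)] @ v) (u @ v)"
| relation: "u \<in> words S \<Longrightarrow> v \<in> words S \<Longrightarrow> l \<in> words S \<Longrightarrow> r \<in> words S \<Longrightarrow> (l, r) \<in> R \<Longrightarrow>
    word_eq S R (u @ l @ v) (u @ r @ v)"

definition word_class :: "'g set \<Rightarrow> ('g word \<times> 'g word) set \<Rightarrow> 'g word \<Rightarrow> 'g word set" where
  "word_class S R w = {v. word_eq S R w v}"

definition presented_group :: "'g set \<Rightarrow> ('g word \<times> 'g word) set \<Rightarrow> 'g word set monoid" where
  "presented_group S R =
    \<lparr>carrier = word_class S R ` words S,
     mult = (\<lambda>A B. \<Union>a\<in>A. \<Union>b\<in>B. word_class S R (a @ b)),
     one = word_class S R []\<rparr>"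

lemma words_simps [simp]:
  "[] \<in> words S"
  "x # w \<in> words S \<longleftrightarrow> fst x \<in> S \<and> w \<in> words S"
  "v @ w \<in> words S \<longleftrightarrow> v \<in> words S \<and> w \<in> words S"
  by (auto simp: words_def)

lemma inv_word_simps [simp]:
  "inv_word [] = []"
  "inv_word ((g, b) # w) = inv_word w @ [(g, \<not> b)]"
  "inv_word (v @ w) = inv_word w @ inv_word v"
  "inv_word (inv_word w) = w"
  "inv_word w \<in> words S \<longleftrightarrow> w \<in> words S"
  by (auto simp: inv_word_def words_def rev_map image_image case_prod_beta o_def)

lemma word_eq_words: "word_eq S R v w \<Longrightarrow> v \<in> words S \<and> w \<in> words S"
  by (induction rule: word_eq.induct) auto

lemma word_eq_append:
  assumes "word_eq S R v v'" "word_eq S R w w'"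
  shows "word_eq S R (v @ w) (v' @ w')"
proof -
  have *: "word_eq S R (x @ y @ z) (x @ y' @ z)"
    if "word_eq S R y y'" "x \<in> words S" "z \<in> words S" for x y y' z
    using that
  proof (induction rule: word_eq.induct)
    case (refl w)
    then show ?case by (intro word_eq.refl) auto
  next
    case (cancel u v g b)
    then show ?case using word_eq.cancel[of "x @ u" S "v @ z" g R b] by simp
  next
    case (relation u v l r)
    then show ?case using word_eq.relation[of "x @ u" S "v @ z" l r R] by simp
  next
    case (sym v w)
    then show ?case by (blast intro: word_eq.sym)
  next
    case (trans u v w)
    then show ?case by (blast intro: word_eq.trans)
  qed
  have "word_eq S R (v @ w) (v' @ w)"
    using *[OF assms(1), of "[]" w] word_eq_words[OF assms(2)] by simp
  moreover have "word_eq S R (v' @ w) (v' @ w')"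
    using *[OF assms(2), of v' "[]"] word_eq_words[OF assms(1)] by simp
  ultimately show ?thesis by (rule word_eq.trans)
qed

lemma word_class_eq_iff:
  assumes "v \<in> words S"
  shows "word_class S R v = word_class S R w \<longleftrightarrow> word_eq S R v w"
proof
  assume "word_class S R v = word_class S R w"
  moreover have "v \<in> word_class S R v"
    using assms by (simp add: word_class_def word_eq.refl)
  ultimately show "word_eq S R v w"
    by (simp add: word_class_def word_eq.sym)
next
  assume "word_eq S R v w"
  then have "word_eq S R v u \<longleftrightarrow> word_eq S R w u" for u
    by (meson word_eq.sym word_eq.trans)
  then show "word_class S R v = word_class S R w"
    by (simp add: word_class_def)
qed

lemma carrier_presented_group: "carrier (presented_group S R) = word_class S R ` words S"
  by (simp add: presented_group_def)

lemma one_presented_group: "\<one>\<^bsub>presented_group S R\<^esub> = word_class S R []"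
  by (simp add: presented_group_def)

lemma mult_presented_group:
  assumes "v \<in> words S" "w \<in> words S"
  shows "word_class S R v \<otimes>\<^bsub>presented_group S R\<^esub> word_class S R w = word_class S R (v @ w)"
proof -
  have "word_class S R (a @ b) = word_class S R (v @ w)"
    if "word_eq S R v a" "word_eq S R w b" for a b
    using that word_eq_append[OF that] word_class_eq_iff[of "v @ w" S R "a @ b"] assms by simp
  moreover have "v \<in> word_class S R v" "w \<in> word_class S R w"
    using assms by (simp_all add: word_class_def word_eq.refl)
  ultimately have "(\<Union>a\<in>word_class S R v. \<Union>b\<in>word_class S R w. word_class S R (a @ b))
      = word_class S R (v @ w)"
    unfolding word_class_def by blast
  then show ?thesis by (simp add: presented_group_def)
qed

lemma word_eq_inv_left: "w \<in> words S \<Longrightarrow> word_eq S R (inv_word w @ w) []"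
proof (induction w)
  case (Cons x w)
  obtain g b where x: "x = (g, b)" by (cases x)
  have "word_eq S R (inv_word w @ [(g, \<not> b), (g, \<not> \<not> b)] @ w) (inv_word w @ w)"
    using Cons.prems x by (intro word_eq.cancel) auto
  moreover have "word_eq S R (inv_word w @ w) []" using Cons by simp
    ultimately have "word_eq S R (inv_word w @ [(g, \<not> b), (g, \<not> \<not> b)] @ w) []"
      by (rule word_eq.trans)
  then show ?case using x by simp
qed (simp add: word_eq.refl)

lemma group_presented_group: "group (presented_group S R)"
proof (rule groupI)
  fix A assume "A \<in> carrier (presented_group S R)"
  then obtain w where w: "A = word_class S R w" "w \<in> words S"
    by (auto simp: carrier_presented_group)
  then have "word_class S R (inv_word w) \<otimes>\<^bsub>presented_group S R\<^esub> A = \<one>\<^bsub>presented_group S R\<^esub>"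
    by (simp add: mult_presented_group one_presented_group word_class_eq_iff word_eq_inv_left)
  then show "\<exists>B\<in>carrier (presented_group S R). B \<otimes>\<^bsub>presented_group S R\<^esub> A = \<one>\<^bsub>presented_group S R\<^esub>"
    using w by (auto simp: carrier_presented_group)
qed (auto simp: carrier_presented_group mult_presented_group one_presented_group)

lemma inv_presented_group:
  assumes "w \<in> words S"
  shows "inv\<^bsub>presented_group S R\<^esub> (word_class S R w) = word_class S R (inv_word w)"
proof -
  interpret group "presented_group S R" by (rule group_presented_group)
  show ?thesis
    by (rule inv_equality)
      (use assms in \<open>auto simp: mult_presented_group one_presented_group carrier_presented_group
        word_class_eq_iff word_eq_inv_left\<close>)
qed


section \<open>Braid groups\<close>

definition braid_relations :: "nat \<Rightarrow> (nat word \<times> nat word) set" where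
  "braid_relations n =
     {([(i, True), (i + 1, True), (i, True)], [(i + 1, True), (i, True), (i + 1, True)]) | i.
        1 \<le> i \<and> i + 1 < n} \<union>
     {([(i, True), (j, True)], [(j, True), (i, True)]) | i j. 1 \<le> i \<and> i + 2 \<le> j \<and> j < n}"

definition braid_group :: "nat \<Rightarrow> nat word set monoid" where
  "braid_group n = presented_group {1..<n} (braid_relations n)"

definition braid :: "nat \<Rightarrow> nat word \<Rightarrow> nat word set" where
  "braid n w = word_class {1..<n} (braid_relations n) w"

abbreviation B3 :: "nat word set monoid" where
  "B3 \<equiv> braid_group 3"

definition \<sigma> :: "nat \<Rightarrow> nat word set" where
  "\<sigma> i = braid 3 [(i, True)]"

text \<open>The puncture that starts in position \<open>p\<close> ends in position \<open>braid_perm w p\<close>.\<close>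

fun braid_perm :: "nat word \<Rightarrow> nat \<Rightarrow> nat" where
  "braid_perm [] = id"
| "braid_perm ((i, e) # w) = braid_perm w \<circ> transpose i (i + 1)"

definition pure_braids :: "nat \<Rightarrow> nat word set set" where
  "pure_braids n = {\<chi> \<in> carrier (braid_group n). \<forall>w\<in>\<chi>. braid_perm w = id}"

text \<open>
  Filling in the puncture that starts in position \<open>p\<close>: the half twists which involve it
  disappear, and the punctures to its right are renumbered.
\<close>

fun fill_in :: "nat \<Rightarrow> nat word \<Rightarrow> nat word" where
  "fill_in p [] = []"
| "fill_in p ((i, e) # w) =
    (if p = i \<or> p = i + 1 then fill_in (transpose i (i + 1) p) w
     else (if i < p then i else i - 1, e) # fill_in p w)"

text \<open>
  Neither condition depends on the representing word; see \<open>in_point_push_iff\<close> below.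
\<close>

definition point_push_protocols :: "nat word set set" ("\<P>\<^sub>2") where
  "\<P>\<^sub>2 = {\<chi> \<in> pure_braids 3. \<forall>w\<in>\<chi>. braid 2 (fill_in 1 w) = \<one>\<^bsub>braid_group 2\<^esub>}"

definition \<alpha>\<^sub>1 :: "nat word set" where
  "\<alpha>\<^sub>1 = \<sigma> 1 [^]\<^bsub>B3\<^esub> (2::nat)"

definition \<alpha>\<^sub>2 :: "nat word set" where
  "\<alpha>\<^sub>2 = \<sigma> 1 \<otimes>\<^bsub>B3\<^esub> \<sigma> 2 [^]\<^bsub>B3\<^esub> (2::nat) \<otimes>\<^bsub>B3\<^esub> inv\<^bsub>B3\<^esub> (\<sigma> 1)"


section \<open>The action on the fundamental group of the three-punctured disk\<close>

text \<open>
  The base point is at the top of the boundary circle, and products of loops are read left to right.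
  The group is free on the loops \<open>x\<^sub>1, x\<^sub>2, x\<^sub>3\<close> which descend straight to the
  respective puncture, go around it counterclockwise and return; \<open>x\<^sub>1 x\<^sub>2 x\<^sub>3\<close> is the
  boundary circle traversed counterclockwise.
\<close>

definition pi1 :: "nat word set monoid" where
  "pi1 = presented_group {1..3} {}"

definition loop :: "nat word \<Rightarrow> nat word set" where
  "loop w = word_class {1..3} {} w"

definition \<delta>\<^sub>1 :: "nat word set" where
  "\<delta>\<^sub>1 = loop [(2, True)]"

definition \<delta>\<^sub>2 :: "nat word set" where
  "\<delta>\<^sub>2 = loop [(3, True)]"

definition \<delta>\<^sub>3 :: "nat word set" where
  "\<delta>\<^sub>3 = inv\<^bsub>pi1\<^esub> (loop [(1, True), (2, True), (3, True)])"

definition subst_word :: "('g \<Rightarrow> 'h word) \<Rightarrow> 'g word \<Rightarrow> 'h word" where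
  "subst_word f w = concat (map (\<lambda>(g, b). if b then f g else inv_word (f g)) w)"

text \<open>
  Image of \<open>x\<^sub>k\<close> under a half twist. In the counterclockwise twist \<open>\<sigma>\<^sub>i\<close> the
  right puncture moves to the left on the side of the base point, so that
  \<open>x\<^sub>i\<^sub>+\<^sub>1\<close> goes to \<open>x\<^sub>i\<close>, while
  \<open>x\<^sub>i x\<^sub>i\<^sub>+\<^sub>1\<close> is preserved.
\<close>

fun artin :: "nat \<times> bool \<Rightarrow> nat \<Rightarrow> nat word" where
  "artin (i, True) k =
    (if k = i then [(i, True), (i + 1, True), (i, False)]
     else if k = i + 1 then [(i, True)] else [(k, True)])"
| "artin (i, False) k =
    (if k = i then [(i + 1, True)]
     else if k = i + 1 then [(i + 1, False), (i, True), (i + 1, True)] else [(k, True)])"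

text \<open>Braid words are read left to right: the first letter acts first.\<close>

fun braid_act :: "nat word \<Rightarrow> nat word \<Rightarrow> nat word" where
  "braid_act [] w = w"
| "braid_act (s # c) w = braid_act c (subst_word (artin s) w)"

definition induced :: "nat word set \<Rightarrow> nat word set \<Rightarrow> nat word set" where
  "induced \<chi> A = (\<Union>c\<in>\<chi>. \<Union>w\<in>A. loop (braid_act c w))"


section \<open>Entropy and efficiency\<close>

definition word_length :: "('a, 'b) monoid_scheme \<Rightarrow> 'a set \<Rightarrow> 'a \<Rightarrow> nat" where
  "word_length G X g = (LEAST n. \<exists>ws. length ws = n \<and> set ws \<subseteq> X \<union> m_inv G ` X \<and>
     foldr (\<lambda>x y. x \<otimes>\<^bsub>G\<^esub> y) ws \<one>\<^bsub>G\<^esub> = g)"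

text \<open>
  With \<open>ln 0 = 0\<close>, a trivial element of \<open>X\<close> contributes \<open>0\<close> rather than \<open>-\<infinity>\<close>; the
  loops \<open>\<delta>\<^sub>i\<close> used below are nontrivial.
\<close>

definition entropy :: "('a, 'b) monoid_scheme \<Rightarrow> 'a set \<Rightarrow> ('a \<Rightarrow> 'a) \<Rightarrow> ereal" where
  "entropy G X a =
     Max ((\<lambda>x. limsup (\<lambda>n. ereal (ln (real (word_length G X ((a ^^ n) x))) / real n))) ` X)"

definition eff :: "nat word set \<Rightarrow> ereal" where
  "eff \<chi> = entropy pi1 {\<delta>\<^sub>1, \<delta>\<^sub>2, \<delta>\<^sub>3} (induced \<chi>) / ereal (real (word_length B3 {\<alpha>\<^sub>1, \<alpha>\<^sub>2} \<chi>))"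

definition Eff2 :: ereal where
  "Eff2 = (SUP \<chi> \<in> \<P>\<^sub>2 - {\<one>\<^bsub>B3\<^esub>}. eff \<chi>)"


section \<open>Well-definedness, and the action in terms of the \<open>\<delta>\<^sub>i\<close>\<close>

lemma braid_eq_iff:
  "v \<in> words {1..<n} \<Longrightarrow> braid n v = braid n w \<longleftrightarrow> word_eq {1..<n} (braid_relations n) v w"
  by (simp add: braid_def word_class_eq_iff)

lemma loop_eq_iff: "v \<in> words {1..3} \<Longrightarrow> loop v = loop w \<longleftrightarrow> word_eq {1..3} {} v w"
  by (simp add: loop_def word_class_eq_iff)

lemma group_braid_group: "group (braid_group n)"
  by (simp add: braid_group_def group_presented_group)

lemma group_pi1: "group pi1"
  by (simp add: pi1_def group_presented_group)

lemma braid_group_simps: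
  "carrier (braid_group n) = braid n ` words {1..<n}"
  "\<one>\<^bsub>braid_group n\<^esub> = braid n []"
  "v \<in> words {1..<n} \<Longrightarrow> w \<in> words {1..<n} \<Longrightarrow>
    braid n v \<otimes>\<^bsub>braid_group n\<^esub> braid n w = braid n (v @ w)"
  "w \<in> words {1..<n} \<Longrightarrow> inv\<^bsub>braid_group n\<^esub> (braid n w) = braid n (inv_word w)"
  by (auto simp: braid_group_def braid_def mult_presented_group one_presented_group
      inv_presented_group carrier_presented_group)

lemma pi1_simps:
  "carrier pi1 = loop ` words {1..3}"
  "\<one>\<^bsub>pi1\<^esub> = loop []"
  "v \<in> words {1..3} \<Longrightarrow> w \<in> words {1..3} \<Longrightarrow> loop v \<otimes>\<^bsub>pi1\<^esub> loop w = loop (v @ w)"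
  "w \<in> words {1..3} \<Longrightarrow> inv\<^bsub>pi1\<^esub> (loop w) = loop (inv_word w)"
  by (auto simp: pi1_def loop_def mult_presented_group one_presented_group
      inv_presented_group carrier_presented_group)

lemma braid_relations_3:
  "(l, r) \<in> braid_relations 3 \<longleftrightarrow>
    l = [(1, True), (2, True), (1, True)] \<and> r = [(2, True), (1, True), (2, True)]"
proof
  assume "(l, r) \<in> braid_relations 3"
  then consider i where "i = 1" "l = [(i, True), (i + 1, True), (i, True)]"
      "r = [(i + 1, True), (i, True), (i + 1, True)]"
    by (auto simp: braid_relations_def)
  then show "l = [(1, True), (2, True), (1, True)] \<and> r = [(2, True), (1, True), (2, True)]"
    by cases simp
qed (auto simp: braid_relations_def intro!: exI[of _ 1])

lemma braid_perm_append: "braid_perm (v @ w) = braid_perm w \<circ> braid_perm v"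
  by (induction v rule: braid_perm.induct) (auto simp: o_assoc)

lemma fill_in_append: "fill_in p (v @ w) = fill_in p v @ fill_in (braid_perm v p) w"
  by (induction p v arbitrary: rule: fill_in.induct) auto

lemma word_eq_braid_perm:
  "word_eq {1..<3} (braid_relations 3) v w \<Longrightarrow> braid_perm v = braid_perm w"
proof (induction rule: word_eq.induct)
  case (cancel u v g b)
  have "transpose g (Suc g) \<circ> transpose g (Suc g) = id" by (rule transpose_comp_involutory)
  then show ?case by (auto simp: braid_perm_append fun_eq_iff)
next
  case (relation u v l r)
  have "braid_perm l = braid_perm r"
    using relation(5) unfolding braid_relations_3
    by (auto simp: fun_eq_iff transpose_def)
  then show ?case by (simp add: braid_perm_append)
qed auto

lemma braid_perm_range: "w \<in> words {1..<n} \<Longrightarrow> p \<in> {1..n} \<Longrightarrow> braid_perm w p \<in> {1..n}"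
proof (induction w arbitrary: p)
  case (Cons s w)
  obtain i e where s: "s = (i, e)" by (cases s)
  have "transpose i (i + 1) p \<in> {1..n}" using Cons.prems s by (auto simp: transpose_def)
  then show ?case using Cons s by simp
qed simp

lemma fill_in_words:
  "w \<in> words {1..<n} \<Longrightarrow> p \<in> {1..n} \<Longrightarrow> fill_in p w \<in> words {1..<n - 1}"
  by (induction p w rule: fill_in.induct) (auto simp: transpose_def)

lemma word_eq_fill_in:
  assumes "word_eq {1..<3} (braid_relations 3) v w" "p \<in> {1..3}"
  shows "word_eq {1..<2} (braid_relations 2) (fill_in p v) (fill_in p w)"
  using assms
proof (induction arbitrary: p rule: word_eq.induct)
  case (refl w)
  then show ?case using fill_in_words[of w 3 p] by (intro word_eq.refl) simp
next
  case (cancel u v g b)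
  define q where "q = braid_perm u p"
  have q: "q \<in> {1..3}" using braid_perm_range[of u 3 p] cancel by (simp add: q_def)
  have u: "fill_in p u \<in> words {1..<2}" and v: "fill_in q v \<in> words {1..<2}"
    using fill_in_words[of u 3 p] fill_in_words[of v 3 q] cancel q by auto
  show ?case
  proof (cases "q = g \<or> q = g + 1")
    case True
    then have "fill_in q ([(g, b), (g, \<not> b)] @ v) = fill_in q v"
      by (elim disjE) (simp_all add: transpose_def)
    then have "fill_in p (u @ [(g, b), (g, \<not> b)] @ v) = fill_in p (u @ v)"
      by (simp add: fill_in_append[of p u] q_def[symmetric])
    then show ?thesis using u v by (simp add: fill_in_append q_def[symmetric] word_eq.refl)
  next
    case False
    define h where "h = (if g < q then g else g - 1)"
    have "h \<in> {1..<2}" using False q cancel(3) by (auto simp: h_def)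
    moreover have "fill_in p (u @ [(g, b), (g, \<not> b)] @ v)
        = fill_in p u @ [(h, b), (h, \<not> b)] @ fill_in q v"
      using False by (simp add: fill_in_append[of p u] q_def[symmetric] h_def)
    ultimately show ?thesis
      using word_eq.cancel[OF u v, of h "braid_relations 2" b]
      by (simp add: fill_in_append q_def[symmetric])
  qed
next
  case (relation u v l r)
  define q where "q = braid_perm u p"
  have q: "q \<in> {1..3}" using braid_perm_range[of u 3 p] relation by (simp add: q_def)
  have q': "braid_perm l q \<in> {1..3}" using braid_perm_range[of l 3 q] relation q by simp
  have "word_eq {1..<3} (braid_relations 3) l r"
    using word_eq.relation[of "[]" "{1..<3}" "[]" l r] relation by simp
  then have perm: "braid_perm l = braid_perm r" by (rule word_eq_braid_perm)
  have "fill_in q l = fill_in q r"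
    using relation(5) q unfolding braid_relations_3
    by (cases "q = 1"; cases "q = 2"; cases "q = 3") (auto simp: transpose_def)
  then have "fill_in p (u @ l @ v) = fill_in p (u @ r @ v)"
    by (simp add: fill_in_append braid_perm_append q_def[symmetric] perm)
  moreover have "fill_in p (u @ l @ v) \<in> words {1..<2}"
    using fill_in_words[of "u @ l @ v" 3 p] relation by simp
  ultimately show ?case by (simp add: word_eq.refl)
qed (blast intro: word_eq.sym word_eq.trans)+

lemma in_point_push_iff:
  assumes "w \<in> words {1..<3}"
  shows "braid 3 w \<in> \<P>\<^sub>2 \<longleftrightarrow> braid_perm w = id \<and> braid 2 (fill_in 1 w) = \<one>\<^bsub>braid_group 2\<^esub>"
proof -
  have "braid_perm v = braid_perm w \<and> braid 2 (fill_in 1 v) = braid 2 (fill_in 1 w)"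
    if "v \<in> braid 3 w" for v
  proof -
    have "word_eq {1..<3} (braid_relations 3) w v"
      using that by (simp add: braid_def word_class_def)
    then show ?thesis
      using word_eq_braid_perm[of w v] word_eq_fill_in[of w v 1] fill_in_words[of w 3 1] assms
        braid_eq_iff[of "fill_in 1 w" 2 "fill_in 1 v"] by simp
  qed
  moreover have "w \<in> braid 3 w" using assms by (simp add: braid_def word_class_def word_eq.refl)
  moreover have "braid 3 w \<in> carrier B3" using assms by (simp add: braid_group_simps)
  ultimately show ?thesis
    unfolding point_push_protocols_def pure_braids_def mem_Collect_eq by metis
qed

lemma \<alpha>_eq_braid:
  "\<alpha>\<^sub>1 = braid 3 [(1, True), (1, True)]"
  "\<alpha>\<^sub>2 = braid 3 [(1, True), (2, True), (2, True), (1, False)]"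
proof -
  interpret group B3 by (rule group_braid_group)
  show "\<alpha>\<^sub>1 = braid 3 [(1, True), (1, True)]"
    "\<alpha>\<^sub>2 = braid 3 [(1, True), (2, True), (2, True), (1, False)]"
    by (simp_all add: \<alpha>\<^sub>1_def \<alpha>\<^sub>2_def \<sigma>_def numeral_2_eq_2 braid_group_simps)
qed

lemma \<alpha>_in_point_push: "\<alpha>\<^sub>1 \<in> \<P>\<^sub>2" "\<alpha>\<^sub>2 \<in> \<P>\<^sub>2"
  by (auto simp: \<alpha>_eq_braid in_point_push_iff braid_group_simps fun_eq_iff transpose_def)

lemma subgroup_point_push: "subgroup \<P>\<^sub>2 B3"
proof -
  interpret group B3 by (rule group_braid_group)
  have carr: "\<exists>w\<in>words {1..<3}. \<chi> = braid 3 w" if "\<chi> \<in> \<P>\<^sub>2" for \<chi>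
    using that by (auto simp: point_push_protocols_def pure_braids_def braid_group_simps)
  have iff: "braid 3 w \<in> \<P>\<^sub>2 \<longleftrightarrow>
      braid_perm w = id \<and> word_eq {1..<2} (braid_relations 2) (fill_in 1 w) []"
    if "w \<in> words {1..<3}" for w
    using that fill_in_words[of w 3 1] braid_eq_iff[of "fill_in 1 w" 2 "[]"]
    by (simp add: in_point_push_iff braid_group_simps)
  have mult: "braid 3 (v @ w) \<in> \<P>\<^sub>2"
    if "braid 3 v \<in> \<P>\<^sub>2" "braid 3 w \<in> \<P>\<^sub>2" "v \<in> words {1..<3}" "w \<in> words {1..<3}" for v w
    using that word_eq_append[of "{1..<2}" "braid_relations 2" "fill_in 1 v" "[]" "fill_in 1 w" "[]"]
    by (simp add: iff braid_perm_append fill_in_append)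
  have inv: "braid 3 (inv_word w) \<in> \<P>\<^sub>2" if w: "braid 3 w \<in> \<P>\<^sub>2" "w \<in> words {1..<3}" for w
  proof -
    have triv: "word_eq {1..<3} (braid_relations 3) (w @ inv_word w) []"
      using word_eq_inv_left[of "inv_word w"] w by simp
    have id: "braid_perm w = id" and fill: "word_eq {1..<2} (braid_relations 2) (fill_in 1 w) []"
      using w by (simp_all add: iff)
    have "braid_perm (inv_word w) = id"
      using word_eq_braid_perm[OF triv] id by (simp add: braid_perm_append)
    moreover have "word_eq {1..<2} (braid_relations 2) (fill_in 1 w @ fill_in 1 (inv_word w)) []"
      using word_eq_fill_in[OF triv, of 1] id by (simp add: fill_in_append)
    moreover have "word_eq {1..<2} (braid_relations 2)
        (fill_in 1 w @ fill_in 1 (inv_word w)) ([] @ fill_in 1 (inv_word w))"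
      using w fill_in_words[of "inv_word w" 3 1] by (intro word_eq_append fill word_eq.refl) simp
    ultimately show ?thesis
      using w by (simp add: iff) (metis word_eq.sym word_eq.trans)
  qed
  show ?thesis
  proof (rule subgroupI)
    show "\<P>\<^sub>2 \<subseteq> carrier B3" by (auto simp: point_push_protocols_def pure_braids_def)
    show "\<P>\<^sub>2 \<noteq> {}" using \<alpha>_in_point_push by auto
    show "inv\<^bsub>B3\<^esub> \<chi> \<in> \<P>\<^sub>2" if "\<chi> \<in> \<P>\<^sub>2" for \<chi>
      using carr[OF that] that inv by (auto simp: braid_group_simps)
    show "\<chi> \<otimes>\<^bsub>B3\<^esub> \<psi> \<in> \<P>\<^sub>2" if "\<chi> \<in> \<P>\<^sub>2" "\<psi> \<in> \<P>\<^sub>2" for \<chi> \<psi>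
      using carr[OF that(1)] carr[OF that(2)] that mult by (auto simp: braid_group_simps)
  qed
qed

fun cancel_cons :: "'g \<times> bool \<Rightarrow> 'g word \<Rightarrow> 'g word" where
  "cancel_cons x [] = [x]"
| "cancel_cons x (y # w) = (if fst x = fst y \<and> snd x \<noteq> snd y then w else x # y # w)"

lemma word_eq_reduce: "w \<in> words S \<Longrightarrow> word_eq S R w (foldr cancel_cons w [])"
proof (induction w)
  case (Cons x w)
  have c: "word_eq S R (x # v) (cancel_cons x v)" if "x # v \<in> words S" for v
  proof (cases v)
    case (Cons y u)
    then show ?thesis
      using that word_eq.cancel[of "[]" S u "fst x" R "snd x"]
      by (cases x; cases y) (auto intro: word_eq.refl)
  qed (use that in \<open>auto intro: word_eq.refl\<close>)
  have w: "word_eq S R w (foldr cancel_cons w [])" using Cons by simp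
  have "word_eq S R (x # w) (x # foldr cancel_cons w [])"
    using word_eq_append[OF word_eq.refl w, of "[x]"] Cons.prems by simp
  then show ?case using c[of "foldr cancel_cons w []"] word_eq_words[OF w] Cons.prems
      word_eq.trans by fastforce
qed (simp add: word_eq.refl)

lemma word_eq_by_reduce:
  assumes "v \<in> words S" "w \<in> words S" "foldr cancel_cons v [] = foldr cancel_cons w []"
  shows "word_eq S R v w"
  using word_eq_reduce[OF assms(1), of R] word_eq_reduce[OF assms(2), of R] assms(3)
  by (metis word_eq.sym word_eq.trans)

lemma subst_word_simps [simp]:
  "subst_word f [] = []"
  "subst_word f ((g, b) # w) = (if b then f g else inv_word (f g)) @ subst_word f w"
  "subst_word f (v @ w) = subst_word f v @ subst_word f w"
  by (auto simp: subst_word_def)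

lemma subst_word_inv: "subst_word f (inv_word w) = inv_word (subst_word f w)"
  by (induction w) auto

lemma subst_word_subst_word:
  "subst_word f (subst_word g w) = subst_word (\<lambda>k. subst_word f (g k)) w"
  by (induction w) (auto simp: subst_word_inv)

lemma subst_word_words:
  "w \<in> words S \<Longrightarrow> (\<And>g. g \<in> S \<Longrightarrow> f g \<in> words T) \<Longrightarrow> subst_word f w \<in> words T"
  by (induction w) auto

lemma word_eq_inv_word: "word_eq S {} v w \<Longrightarrow> word_eq S {} (inv_word v) (inv_word w)"
proof (induction rule: word_eq.induct)
  case (cancel u v g b)
  then show ?case using word_eq.cancel[of "inv_word v" S "inv_word u" g "{}" b] by simp
qed (simp_all add: word_eq.refl, (blast intro: word_eq.sym word_eq.trans)+)

lemma word_eq_subst_cong: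
  assumes "w \<in> words S" "\<And>k. k \<in> S \<Longrightarrow> word_eq T {} (f k) (g k)"
  shows "word_eq T {} (subst_word f w) (subst_word g w)"
  using assms by (induction w) (auto intro!: word_eq_append word_eq_inv_word word_eq.refl)

lemma word_eq_subst:
  assumes "word_eq S {} v w" "\<And>k. k \<in> S \<Longrightarrow> f k \<in> words T"
  shows "word_eq T {} (subst_word f v) (subst_word f w)"
  using assms
proof (induction rule: word_eq.induct)
  case (refl w)
  then show ?case by (intro word_eq.refl subst_word_words)
next
  case (cancel u v g b)
  have g: "f g \<in> words T" using cancel by auto
  have "word_eq T {} (subst_word f [(g, b), (g, \<not> b)]) []"
    using word_eq_inv_left[OF g] word_eq_inv_left[of "inv_word (f g)" T] g by (cases b) auto
  moreover have "subst_word f u \<in> words T" "subst_word f v \<in> words T"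
    using cancel by (auto intro: subst_word_words)
  ultimately have "word_eq T {} (subst_word f u @ subst_word f [(g, b), (g, \<not> b)] @ subst_word f v)
      (subst_word f u @ [] @ subst_word f v)"
    by (intro word_eq_append) (auto intro: word_eq.refl)
  then show ?case by simp
qed (blast intro: word_eq.sym word_eq.trans)+

lemma braid_act_append: "braid_act (c @ d) w = braid_act d (braid_act c w)"
  by (induction c arbitrary: w) simp_all

lemma braid_act_eq_subst: "braid_act c w = subst_word (\<lambda>k. braid_act c [(k, True)]) w"
proof (induction c arbitrary: w)
  case Nil
  have "subst_word (\<lambda>k. [(k, True)]) w = w" by (induction w) auto
  then show ?case by simp
next
  case (Cons s c)
  have "braid_act (s # c) w = subst_word (\<lambda>k. braid_act c [(k, True)]) (subst_word (artin s) w)"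
    using Cons[of "subst_word (artin s) w"] by (simp only: braid_act.simps)
  also have "\<dots> = subst_word (\<lambda>k. subst_word (\<lambda>j. braid_act c [(j, True)]) (artin s k)) w"
    by (simp add: subst_word_subst_word)
  also have "(\<lambda>k. subst_word (\<lambda>j. braid_act c [(j, True)]) (artin s k)) =
      (\<lambda>k. braid_act (s # c) [(k, True)])"
  proof
    fix k
    have "subst_word (artin s) [(k, True)] = artin s k" by simp
    then show "subst_word (\<lambda>j. braid_act c [(j, True)]) (artin s k) = braid_act (s # c) [(k, True)]"
      using Cons[of "artin s k"] by (simp only: braid_act.simps)
  qed
  finally show ?case .
qed

lemma artin_words: "fst s \<in> {1..<3} \<Longrightarrow> k \<in> {1..3} \<Longrightarrow> artin s k \<in> words {1..3}"
  by (cases "(s, k)" rule: artin.cases) auto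

lemma braid_act_words:
  "c \<in> words {1..<3} \<Longrightarrow> w \<in> words {1..3} \<Longrightarrow> braid_act c w \<in> words {1..3}"
proof (induction c arbitrary: w)
  case (Cons s c)
  then have "subst_word (artin s) w \<in> words {1..3}"
    by (intro subst_word_words[of w "{1..3}"] artin_words) auto
  then show ?case using Cons by simp
qed simp

lemma braid_act_cong:
  assumes "word_eq {1..3} {} v w" "c \<in> words {1..<3}"
  shows "word_eq {1..3} {} (braid_act c v) (braid_act c w)"
  unfolding braid_act_eq_subst[of c v] braid_act_eq_subst[of c w]
  by (rule word_eq_subst[OF assms(1)]) (rule braid_act_words[OF assms(2)], simp)

lemma atLeastAtMost_1_3: "{1..3::nat} = {1, 2, 3}"
  by auto

lemma atLeastLessThan_1_3: "{1..<3::nat} = {1, 2}"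
  by auto

lemma word_eq_braid_act:
  assumes "word_eq {1..<3} (braid_relations 3) c d" "w \<in> words {1..3}"
  shows "word_eq {1..3} {} (braid_act c w) (braid_act d w)"
proof -
  have *: "word_eq {1..3} {} (braid_act (u @ l @ v) w) (braid_act (u @ r @ v) w)"
    if gen: "\<And>k. k \<in> {1..3} \<Longrightarrow> word_eq {1..3} {} (braid_act l [(k, True)]) (braid_act r [(k, True)])"
      and "u \<in> words {1..<3}" "v \<in> words {1..<3}" "w \<in> words {1..3}" for u l r v w
  proof -
    have "word_eq {1..3} {} (braid_act l x) (braid_act r x)" if "x \<in> words {1..3}" for x
      unfolding braid_act_eq_subst[of l x] braid_act_eq_subst[of r x]
      by (rule word_eq_subst_cong[OF that gen])
    then show ?thesis
      unfolding braid_act_append by (rule braid_act_cong) (intro braid_act_words that)+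
  qed
  from assms show ?thesis
  proof (induction arbitrary: w rule: word_eq.induct)
    case (refl c)
    show ?case by (rule word_eq.refl) (rule braid_act_words[OF refl])
  next
    case (cancel u v g b)
    have "word_eq {1..3} {} (braid_act [(g, b), (g, \<not> b)] [(k, True)]) (braid_act [] [(k, True)])"
      if "k \<in> {1..3}" for k
      using that cancel(3) unfolding atLeastAtMost_1_3 atLeastLessThan_1_3
      by (intro word_eq_by_reduce; cases b; elim insertE emptyE; simp)
    from *[OF this cancel(1,2,4)] show ?case by simp
  next
    case (relation u v l r)
    have "word_eq {1..3} {} (braid_act l [(k, True)]) (braid_act r [(k, True)])"
      if "k \<in> {1..3}" for k
      using that relation(5) unfolding atLeastAtMost_1_3 braid_relations_3
      by (intro word_eq_by_reduce; elim conjE insertE emptyE; simp)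
    from *[OF this relation(1,2,6)] show ?case .
  next
    case (sym c d)
    show ?case by (rule word_eq.sym) (rule sym.IH[OF sym.prems])
  next
    case (trans c d e)
    show ?case by (rule word_eq.trans[OF trans.IH(1)[OF trans.prems] trans.IH(2)[OF trans.prems]])
  qed
qed

lemma induced_braid_loop:
  assumes "c \<in> words {1..<3}" "w \<in> words {1..3}"
  shows "induced (braid 3 c) (loop w) = loop (braid_act c w)"
proof -
  have "loop (braid_act d v) = loop (braid_act c w)" if "d \<in> braid 3 c" "v \<in> loop w" for d v
  proof -
    have d: "word_eq {1..<3} (braid_relations 3) c d" and v: "word_eq {1..3} {} w v"
      using that by (auto simp: braid_def loop_def word_class_def)
    have "word_eq {1..3} {} (braid_act c w) (braid_act d v)"
      using word_eq_braid_act[OF d assms(2)] braid_act_cong[OF v] word_eq_words[OF d]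
      by (meson word_eq.trans)
    then show ?thesis using assms by (metis braid_act_words loop_eq_iff)
  qed
  moreover have "c \<in> braid 3 c" "w \<in> loop w"
    using assms by (auto simp: braid_def loop_def word_class_def word_eq.refl)
  ultimately show ?thesis unfolding induced_def by blast
qed

lemma induced_mult:
  assumes "\<chi> \<in> carrier B3" "\<psi> \<in> carrier B3" "A \<in> carrier pi1"
  shows "induced (\<chi> \<otimes>\<^bsub>B3\<^esub> \<psi>) A = induced \<psi> (induced \<chi> A)"
  using assms
  by (auto simp: braid_group_simps pi1_simps induced_braid_loop braid_act_append braid_act_words simp del: One_nat_def)

lemma induced_iso:
  assumes "\<chi> \<in> carrier B3"
  shows "induced \<chi> \<in> iso pi1 pi1"
proof -
  interpret group B3 by (rule group_braid_group)
  have closed: "induced \<psi> A \<in> carrier pi1" if "\<psi> \<in> carrier B3" "A \<in> carrier pi1" for \<psi> A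
    using that by (auto simp: braid_group_simps pi1_simps induced_braid_loop braid_act_words simp del: One_nat_def)
  have mult: "induced \<chi> (A \<otimes>\<^bsub>pi1\<^esub> B) = induced \<chi> A \<otimes>\<^bsub>pi1\<^esub> induced \<chi> B"
    if AB: "A \<in> carrier pi1" "B \<in> carrier pi1" for A B
  proof -
    obtain c v w where c: "\<chi> = braid 3 c" "c \<in> words {1..<3}" and
      v: "A = loop v" "v \<in> words {1..3}" and w: "B = loop w" "w \<in> words {1..3}"
      using assms AB by (auto simp: braid_group_simps pi1_simps)
    have "braid_act c (v @ w) = braid_act c v @ braid_act c w"
      using braid_act_eq_subst[of c "v @ w"] braid_act_eq_subst[of c v] braid_act_eq_subst[of c w]
      by simp
    then show ?thesis
      using c v w by (simp add: pi1_simps induced_braid_loop braid_act_words del: One_nat_def)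
  qed
  have one: "induced \<one>\<^bsub>B3\<^esub> A = A" if "A \<in> carrier pi1" for A
    using that by (auto simp: braid_group_simps pi1_simps induced_braid_loop)
  have inv: "induced (inv\<^bsub>B3\<^esub> \<chi>) (induced \<chi> A) = A" "induced \<chi> (induced (inv\<^bsub>B3\<^esub> \<chi>) A) = A"
    if "A \<in> carrier pi1" for A
    using that assms one by (simp_all flip: induced_mult)
  have "bij_betw (induced \<chi>) (carrier pi1) (carrier pi1)"
    by (rule bij_betwI[where g = "induced (inv\<^bsub>B3\<^esub> \<chi>)"]) (use closed inv assms in auto)
  then show ?thesis using mult closed assms by (auto simp: iso_def hom_def)
qed

lemma \<delta>_eq_loop:
  "\<delta>\<^sub>1 = loop [(2, True)]" "\<delta>\<^sub>2 = loop [(3, True)]"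
  "\<delta>\<^sub>3 = loop [(3, False), (2, False), (1, False)]"
  by (simp_all add: \<delta>\<^sub>1_def \<delta>\<^sub>2_def \<delta>\<^sub>3_def pi1_simps)

lemma loop_eqI:
  assumes "v \<in> words {1..3}" "w \<in> words {1..3}"
    and "foldr cancel_cons v [] = foldr cancel_cons w []"
  shows "loop v = loop w"
  using word_eq_by_reduce[OF assms] loop_eq_iff[OF assms(1)] by blast

lemma induced_\<alpha>\<^sub>1:
  "induced \<alpha>\<^sub>1 \<delta>\<^sub>1 = inv\<^bsub>pi1\<^esub> (\<delta>\<^sub>2 \<otimes>\<^bsub>pi1\<^esub> \<delta>\<^sub>3) \<otimes>\<^bsub>pi1\<^esub> \<delta>\<^sub>1 \<otimes>\<^bsub>pi1\<^esub> (\<delta>\<^sub>2 \<otimes>\<^bsub>pi1\<^esub> \<delta>\<^sub>3)"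
  "induced \<alpha>\<^sub>1 \<delta>\<^sub>2 = \<delta>\<^sub>2" "induced \<alpha>\<^sub>1 \<delta>\<^sub>3 = \<delta>\<^sub>3"
  by (simp_all add: \<alpha>_eq_braid \<delta>_eq_loop pi1_simps induced_braid_loop) (rule loop_eqI; simp)+

lemma induced_\<alpha>\<^sub>2:
  "induced \<alpha>\<^sub>2 \<delta>\<^sub>2 = inv\<^bsub>pi1\<^esub> (\<delta>\<^sub>3 \<otimes>\<^bsub>pi1\<^esub> \<delta>\<^sub>1) \<otimes>\<^bsub>pi1\<^esub> \<delta>\<^sub>2 \<otimes>\<^bsub>pi1\<^esub> (\<delta>\<^sub>3 \<otimes>\<^bsub>pi1\<^esub> \<delta>\<^sub>1)"
  "induced \<alpha>\<^sub>2 \<delta>\<^sub>1 = \<delta>\<^sub>1" "induced \<alpha>\<^sub>2 \<delta>\<^sub>3 = \<delta>\<^sub>3"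
  by (simp_all add: \<alpha>_eq_braid \<delta>_eq_loop pi1_simps induced_braid_loop) (rule loop_eqI; simp)+

lemma \<delta>_generate: "loop [(1, True)] = inv\<^bsub>pi1\<^esub> (\<delta>\<^sub>2 \<otimes>\<^bsub>pi1\<^esub> \<delta>\<^sub>3) \<otimes>\<^bsub>pi1\<^esub> inv\<^bsub>pi1\<^esub> \<delta>\<^sub>1"
  by (simp add: \<delta>_eq_loop pi1_simps) (rule loop_eqI; simp)

end

theory Submission
  imports Defs
begin

text \<open>
  In the loops \<open>\<delta>\<^sub>i\<close> the generators act by a shear on letter counts. Ignoring signs and
  cancellation, \<open>\<alpha>\<^sub>1\<close> and its inverse replace a letter \<open>\<delta>\<^sub>1\<close> by one \<open>\<delta>\<^sub>1\<close>, two
  \<open>\<delta>\<^sub>2\<close> and two \<open>\<delta>\<^sub>3\<close>, and \<open>\<alpha>\<^sub>2\<close> and its inverse do the same with the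
  indices \<open>1\<close> and \<open>2\<close> exchanged; \<open>\<delta>\<^sub>3\<close> is fixed. So the counts of \<open>\<delta>\<^sub>1\<close> and
  \<open>\<delta>\<^sub>2\<close> change by the matrix with rows \<open>(1, 0), (2, 1)\<close> or by its transpose.

  Upper bound: both matrices have Euclidean operator norm \<open>1 + sqrt 2\<close> (\<open>shear_norm\<close>). Hence \<open>N\<close>
  letters \<open>\<alpha>\<^sub>j\<close> increase the counts by a factor of at most \<open>(1 + sqrt 2) ^ N\<close>. The count of
  \<open>\<delta>\<^sub>3\<close> feeds on the other two and obeys a bound of the same order, because the sum of a
  geometric series with ratio at least \<open>2\<close> is comparable to its last term. This gives
  \<open>h(\<chi>) \<le> L(\<chi>) ln (1 + sqrt 2)\<close> (\<open>delta_length_growth_le\<close>, \<open>entropy_le\<close>). For \<open>L(\<chi>)\<close> to mean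
  anything, \<open>\<chi>\<close> must be a product of the \<open>\<alpha>\<^sub>j\<close>; that these generate
  \<open>\<P>\<^sub>2\<close> is proved by combing braids (\<open>point_push_generated\<close>).

  Lower bound: for \<open>\<alpha>\<^sub>1 \<alpha>\<^sub>2\<^sup>-\<^sup>1\<close> the product of the two matrices is symmetric
  with rows \<open>(5, 2), (2, 1)\<close>, and its largest eigenvalue \<open>3 + 2 sqrt 2\<close> is the square of the norm
  above. The letter count of an iterate is the true word length because no cancellation ever occurs:
  the induced substitution preserves a set of words in which every pair of adjacent letters has
  images that meet without cancelling, and these words are reduced (\<open>legal_beta\<close>,
  \<open>legal_word_reduced\<close>, \<open>delta_length_beta_ge\<close>).
\<close>

(* The index 1 of a generator should not turn into Suc 0. *)
declare One_nat_def [simp del]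

section \<open>Word length in presented groups\<close>

text \<open>
Replacing lists of group elements by words in the index set reduces a statement about word length
to one about substitutions and the relation \<open>word_eq\<close>.
\<close>

lemma word_length_presented_group:
  assumes f: "\<And>i. i \<in> I \<Longrightarrow> f i \<in> words S"
  shows "word_length (presented_group S R) ((\<lambda>i. word_class S R (f i)) ` I) (word_class S R v) =
    (LEAST n. \<exists>w\<in>words I. length w = n \<and> word_eq S R (subst_word f w) v)"
proof -
  let ?G = "presented_group S R"
  let ?x = "\<lambda>i. word_class S R (f i)"
  define letter where "letter = (\<lambda>(i, b). if b then ?x i else inv\<^bsub>?G\<^esub> (?x i))"
  have val: "foldr (\<lambda>x y. x \<otimes>\<^bsub>?G\<^esub> y) (map letter w) \<one>\<^bsub>?G\<^esub> = word_class S R (subst_word f w)"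
    if "w \<in> words I" for w
    using that
  proof (induction w)
    case (Cons s w)
    have "subst_word f w \<in> words S" using Cons.prems f by (intro subst_word_words) auto
    then show ?case
      using Cons f by (cases s) (auto simp: letter_def mult_presented_group inv_presented_group)
  qed (simp add: one_presented_group)
  have "letter ` (I \<times> UNIV) = ?x ` I \<union> m_inv ?G ` ?x ` I"
  proof -
    have "I \<times> UNIV = (\<lambda>i. (i, True)) ` I \<union> (\<lambda>i. (i, False)) ` I"
    proof (intro equalityI subsetI)
      fix p assume "p \<in> I \<times> (UNIV :: bool set)"
      then show "p \<in> (\<lambda>i. (i, True)) ` I \<union> (\<lambda>i. (i, False)) ` I" by (cases p; cases "snd p") auto
    qed auto
    then show ?thesis by (simp add: image_Un image_image letter_def)
  qed
  then have "{ws. set ws \<subseteq> ?x ` I \<union> m_inv ?G ` ?x ` I} = map letter ` lists (I \<times> UNIV)"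
    by (metis lists_image lists_eq_set)
  moreover have "lists (I \<times> UNIV) = words I"
    by (auto simp: words_def lists_eq_set)
  ultimately have lists: "{ws. set ws \<subseteq> ?x ` I \<union> m_inv ?G ` ?x ` I} = map letter ` words I"
    by simp
  have "(\<exists>ws. length ws = n \<and> set ws \<subseteq> ?x ` I \<union> m_inv ?G ` ?x ` I \<and>
      foldr (\<lambda>x y. x \<otimes>\<^bsub>?G\<^esub> y) ws \<one>\<^bsub>?G\<^esub> = word_class S R v) \<longleftrightarrow>
    (\<exists>ws\<in>{ws. set ws \<subseteq> ?x ` I \<union> m_inv ?G ` ?x ` I}. length ws = n \<and>
      foldr (\<lambda>x y. x \<otimes>\<^bsub>?G\<^esub> y) ws \<one>\<^bsub>?G\<^esub> = word_class S R v)" for n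
    by blast
  also have "\<dots> n \<longleftrightarrow> (\<exists>w\<in>words I. length w = n \<and> word_class S R (subst_word f w) = word_class S R v)" for n
    unfolding lists bex_simps by (simp add: val cong: bex_cong conj_cong)
  also have "\<dots> n \<longleftrightarrow> (\<exists>w\<in>words I. length w = n \<and> word_eq S R (subst_word f w) v)" for n
    by (rule bex_cong[OF HOL.refl]) (simp add: word_class_eq_iff subst_word_words[OF _ f])
  finally show ?thesis by (simp add: word_length_def)
qed

section \<open>Reduced words in free groups\<close>

definition mutually_inverse :: "'g \<times> bool \<Rightarrow> 'g \<times> bool \<Rightarrow> bool" where
  "mutually_inverse x y \<longleftrightarrow> fst x = fst y \<and> snd x \<noteq> snd y"

abbreviation reduced :: "'g word \<Rightarrow> bool" where
  "reduced \<equiv> successively (\<lambda>x y. \<not> mutually_inverse x y)"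

lemma reduced_cancel_cons: "reduced w \<Longrightarrow> reduced (cancel_cons x w)"
  by (cases "(x, w)" rule: cancel_cons.cases)
    (auto simp: mutually_inverse_def successively_Cons)

lemma reduced_foldr_cancel_cons: "reduced (foldr cancel_cons w [])"
  by (induction w) (auto intro: reduced_cancel_cons)

lemma foldr_cancel_cons_reduced: "reduced w \<Longrightarrow> foldr cancel_cons w [] = w"
proof (induction w)
  case (Cons x w)
  then show ?case by (cases w) (auto simp: mutually_inverse_def)
qed simp

lemma length_foldr_cancel_cons: "length (foldr cancel_cons w []) \<le> length w"
proof (induction w)
  case (Cons x w)
  have "length (cancel_cons x v) \<le> Suc (length v)" for v
    by (cases "(x, v)" rule: cancel_cons.cases) auto
  from this[of "foldr cancel_cons w []"] Cons show ?case by simp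
qed simp

text \<open>
Mutually inverse letters act on reduced words by mutually inverse maps, so that the free group acts
on them. This is what makes the reduced form of a group element well defined.
\<close>

lemma cancel_cons_cancel_cons:
  assumes "reduced w"
  shows "cancel_cons (g, b) (cancel_cons (g, \<not> b) w) = w"
proof (cases w)
  case (Cons y v)
  then show ?thesis using assms
    by (cases y; cases v) (auto simp: mutually_inverse_def)
qed simp

lemma word_eq_imp_foldr_cancel_cons_eq:
  "word_eq S {} v w \<Longrightarrow> foldr cancel_cons v [] = foldr cancel_cons w []"
proof (induction rule: word_eq.induct)
  case (cancel u v g b)
  then show ?case using cancel_cons_cancel_cons[OF reduced_foldr_cancel_cons, of g b v] by simp
qed auto

lemma length_reduced_le:
  assumes "word_eq S {} v w" "reduced w"
  shows "length w \<le> length v"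
  using word_eq_imp_foldr_cancel_cons_eq[OF assms(1)] foldr_cancel_cons_reduced[OF assms(2)]
    length_foldr_cancel_cons[of v] by simp

text \<open>
A property of adjacent letters survives a substitution if it holds inside the image of each letter
and at each place where the images of two adjacent letters meet.
\<close>

lemma successively_subst_word:
  assumes "w \<in> words S" "successively P w"
    and "\<And>x. fst x \<in> S \<Longrightarrow> subst_word f [x] \<noteq> [] \<and> successively P (subst_word f [x])"
    and "\<And>x y. fst x \<in> S \<Longrightarrow> fst y \<in> S \<Longrightarrow> P x y \<Longrightarrow>
      P (last (subst_word f [x])) (hd (subst_word f [y]))"
  shows "successively P (subst_word f w)"
  using assms(1,2)
proof (induction w)
  case (Cons x w)
  have cons: "subst_word f (z # v) = subst_word f [z] @ subst_word f v" for z v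
    by (cases z) simp
  show ?case
  proof (cases w)
    case Nil
    then show ?thesis using Cons assms(3)[of x] by simp
  next
    case (Cons y v)
    have "hd (subst_word f w) = hd (subst_word f [y])"
      using assms(3)[of y] Cons Cons.prems unfolding Cons cons[of y v] by simp
    moreover have "successively P (subst_word f w)" using Cons.IH Cons.prems Cons by simp
    moreover have "P (last (subst_word f [x])) (hd (subst_word f [y]))"
      using assms(4)[of x y] Cons Cons.prems by simp
    ultimately show ?thesis
      using assms(3)[of x] Cons.prems
      unfolding cons[of x w] successively_append_iff by auto
  qed
qed simp

section \<open>Generators of the point-push group\<close>

definition alpha_word :: "nat \<Rightarrow> nat word" where
  "alpha_word i = (if i = 1 then [(1, True), (1, True)]
     else [(1, True), (2, True), (2, True), (1, False)])"

lemma alpha_word_simps [simp]: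
  "alpha_word 1 = [(1, True), (1, True)]"
  "alpha_word 2 = [(1, True), (2, True), (2, True), (1, False)]"
  by (auto simp: alpha_word_def)

lemma alpha_word_words: "alpha_word i \<in> words {1..<3}"
  by (simp add: alpha_word_def)

lemma subst_alpha_word_words: "u \<in> words {1, 2} \<Longrightarrow> subst_word alpha_word u \<in> words {1..<3}"
  by (rule subst_word_words) (auto intro: alpha_word_words)

definition braid_eq :: "nat word \<Rightarrow> nat word \<Rightarrow> bool" (infix "\<approx>" 50) where
  "v \<approx> w \<longleftrightarrow> word_eq {1..<3} (braid_relations 3) v w"

lemma braid_eq_refl: "w \<in> words {1..<3} \<Longrightarrow> w \<approx> w"
  and braid_eq_sym: "v \<approx> w \<Longrightarrow> w \<approx> v"
  and braid_eq_trans [trans]: "u \<approx> v \<Longrightarrow> v \<approx> w \<Longrightarrow> u \<approx> w"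
  and braid_eq_append: "v \<approx> v' \<Longrightarrow> w \<approx> w' \<Longrightarrow> v @ w \<approx> v' @ w'"
  unfolding braid_eq_def by (rule word_eq.refl word_eq.sym word_eq.trans word_eq_append; assumption)+

lemma braid_eq_by_reduce:
  "v \<in> words {1..<3} \<Longrightarrow> w \<in> words {1..<3} \<Longrightarrow> foldr cancel_cons v [] = foldr cancel_cons w [] \<Longrightarrow> v \<approx> w"
  unfolding braid_eq_def by (rule word_eq_by_reduce)

lemma braid_eq_relation:
  assumes "u \<in> words {1..<3}" "v \<in> words {1..<3}"
  shows "u @ [(1, True), (2, True), (1, True)] @ v \<approx> u @ [(2, True), (1, True), (2, True)] @ v"
  unfolding braid_eq_def
  by (rule word_eq.relation) (use assms in \<open>auto simp: braid_relations_3\<close>)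

lemma braid_eq_via_relation:
  assumes "u \<in> words {1..<3}" "v \<in> words {1..<3}" "l \<in> words {1..<3}" "r \<in> words {1..<3}"
    and "foldr cancel_cons l [] = foldr cancel_cons (u @ [(1, True), (2, True), (1, True)] @ v) []"
    and "foldr cancel_cons r [] = foldr cancel_cons (u @ [(2, True), (1, True), (2, True)] @ v) []"
  shows "l \<approx> r"
  by (rule braid_eq_trans[OF braid_eq_by_reduce braid_eq_trans[OF
    braid_eq_relation[OF assms(1,2)] braid_eq_by_reduce]]) (use assms in auto)

lemma braid_eq_inv_word:
  assumes "v \<approx> w"
  shows "inv_word v \<approx> inv_word w"
proof -
  have vw: "v \<in> words {1..<3}" "w \<in> words {1..<3}"
    using word_eq_words assms by (auto simp: braid_eq_def)
  then have inv: "inv_word v \<in> words {1..<3}" "inv_word w \<in> words {1..<3}" by simp_all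
  have "inv_word v \<approx> inv_word v @ w @ inv_word w"
    using braid_eq_append[OF braid_eq_refl[OF inv(1)], of "w @ inv_word w" "[]"]
      word_eq_inv_left[of "inv_word w"] vw by (simp add: braid_eq_def word_eq.sym)
  also have "\<dots> \<approx> inv_word v @ v @ inv_word w"
    by (intro braid_eq_append braid_eq_refl inv braid_eq_sym[OF assms])
  also have "\<dots> \<approx> inv_word w"
    using braid_eq_append[OF _ braid_eq_refl[OF inv(2)], of "inv_word v @ v" "[]"]
      word_eq_inv_left[of v] vw by (simp add: braid_eq_def)
  finally show ?thesis .
qed

definition alpha_product :: "nat word \<Rightarrow> bool" where
  "alpha_product w \<longleftrightarrow> (\<exists>u\<in>words {1, 2}. subst_word alpha_word u \<approx> w)"

lemma alpha_product_words: "alpha_product w \<Longrightarrow> w \<in> words {1..<3}"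
  unfolding alpha_product_def braid_eq_def using word_eq_words by blast

lemma alpha_product_subst: "u \<in> words {1, 2} \<Longrightarrow> alpha_product (subst_word alpha_word u)"
  unfolding alpha_product_def using braid_eq_refl subst_alpha_word_words by blast

lemma alpha_product_cong: "alpha_product v \<Longrightarrow> v \<approx> w \<Longrightarrow> alpha_product w"
  unfolding alpha_product_def using braid_eq_trans by blast

lemma alpha_product_append:
  assumes "alpha_product v" "alpha_product w"
  shows "alpha_product (v @ w)"
proof -
  obtain a b where "a \<in> words {1, 2}" "subst_word alpha_word a \<approx> v"
    "b \<in> words {1, 2}" "subst_word alpha_word b \<approx> w"
    using assms unfolding alpha_product_def by blast
  then show ?thesis
    unfolding alpha_product_def using braid_eq_append by (intro bexI[of _ "a @ b"]) auto
qed

lemma alpha_product_inv: 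
  assumes "alpha_product w"
  shows "alpha_product (inv_word w)"
proof -
  obtain a where "a \<in> words {1, 2}" "subst_word alpha_word a \<approx> w"
    using assms unfolding alpha_product_def by blast
  then show ?thesis
    unfolding alpha_product_def using braid_eq_inv_word
    by (intro bexI[of _ "inv_word a"]) (auto simp: subst_word_inv)
qed

text \<open>
Since \<open>\<sigma>\<^sub>2\<close> fixes the stirrer, conjugation by it maps protocols to protocols; these are the explicit
expressions. Each follows from a few uses of the braid relation.
\<close>

lemma conjugates_of_alpha:
  "[(2, True), (1, True), (1, True), (2, False)] \<approx>
    subst_word alpha_word [(1, False), (2, True), (1, True)]"
  "[(2, False), (1, True), (1, True), (2, True)] \<approx> alpha_word 2"
  "[(2, True), (1, True), (2, True), (2, True), (1, False), (2, False)] \<approx> alpha_word 1"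
  "[(2, False), (1, True), (2, True), (2, True), (1, False), (2, True)] \<approx>
    subst_word alpha_word [(2, True), (1, True), (2, False)]"
proof -
  \<comment> \<open>\<open>\<sigma>\<^sub>1\<^sup>-\<^sup>1 \<sigma>\<^sub>2\<^sup>2 \<sigma>\<^sub>1 = \<sigma>\<^sub>2 \<sigma>\<^sub>1\<^sup>2 \<sigma>\<^sub>2\<^sup>-\<^sup>1\<close>, inside any word\<close>
  have a: "w1 @ [(1, False), (2, True), (2, True), (1, True)] @ w2 \<approx>
      w1 @ [(2, True), (1, True), (1, True), (2, False)] @ w2"
    if w: "w1 \<in> words {1..<3}" "w2 \<in> words {1..<3}" for w1 w2
  proof -
    have "[(1, False), (2, True), (2, True), (1, True)] \<approx>
        [(1, False), (2, True), (1, True), (2, True), (1, True), (2, False)]"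
      by (rule braid_eq_sym,
          rule braid_eq_via_relation[of "[(1, False), (2, True)]" "[(2, False)]"]) auto
    also have "\<dots> \<approx> [(2, True), (1, True), (1, True), (2, False)]"
      by (rule braid_eq_sym,
          rule braid_eq_via_relation[of "[(1, False)]" "[(1, True), (2, False)]"]) auto
    finally show ?thesis using w by (intro braid_eq_append braid_eq_refl)
  qed
  have b: "[(2, False), (1, True), (1, True), (2, True)] \<approx> alpha_word 2"
  proof -
    \<comment> \<open>The claim is the square of this relation between conjugates of half twists.\<close>
    have c: "[(2, False), (1, True), (2, True)] \<approx> [(1, True), (2, True), (1, False)]"
      by (rule braid_eq_via_relation[of "[(2, False)]" "[(1, False)]"]) auto
    have "[(2, False), (1, True), (1, True), (2, True)] \<approx>
        [(2, False), (1, True), (2, True)] @ [(2, False), (1, True), (2, True)]"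
      by (rule braid_eq_by_reduce) auto
    also have "\<dots> \<approx> [(1, True), (2, True), (1, False)] @ [(1, True), (2, True), (1, False)]"
      by (intro braid_eq_append c)
    also have "\<dots> \<approx> alpha_word 2" by (rule braid_eq_by_reduce) auto
    finally show ?thesis .
  qed
  show "[(2, True), (1, True), (1, True), (2, False)] \<approx>
      subst_word alpha_word [(1, False), (2, True), (1, True)]"
  proof -
    have "[(2, True), (1, True), (1, True), (2, False)] \<approx>
        [(1, False), (2, True), (2, True), (1, True)]"
      using a[of "[]" "[]"] by (simp add: braid_eq_sym)
    also have "\<dots> \<approx> subst_word alpha_word [(1, False), (2, True), (1, True)]"
      by (rule braid_eq_by_reduce) auto
    finally show ?thesis .
  qed
  show "[(2, False), (1, True), (1, True), (2, True)] \<approx> alpha_word 2" by (rule b)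
  show "[(2, True), (1, True), (2, True), (2, True), (1, False), (2, False)] \<approx> alpha_word 1"
  proof -
    have "[(2, True)] @ alpha_word 2 @ [(2, False)] \<approx>
        [(2, True)] @ [(2, False), (1, True), (1, True), (2, True)] @ [(2, False)]"
      by (intro braid_eq_append braid_eq_sym[OF b] braid_eq_refl) auto
    also have "\<dots> \<approx> alpha_word 1" by (rule braid_eq_by_reduce) auto
    finally show ?thesis by simp
  qed
  show "[(2, False), (1, True), (2, True), (2, True), (1, False), (2, True)] \<approx>
      subst_word alpha_word [(2, True), (1, True), (2, False)]"
  proof -
    have "[(2, False), (1, True), (2, True), (2, True), (1, False), (2, True)] \<approx>
        [(1, True), (2, True), (1, False), (2, True), (1, False), (2, True)]"
      by (rule braid_eq_via_relation[of "[(2, False)]" "[(1, False), (2, True), (1, False), (2, True)]"])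
        auto
    also have "\<dots> \<approx> [(1, True), (2, True), (1, False), (2, True), (2, True), (1, True), (2, False), (1, False)]"
      by (rule braid_eq_sym, rule braid_eq_via_relation[of
            "[(1, True), (2, True), (1, False), (2, True), (1, False)]" "[(2, False), (1, False)]"]) auto
    also have "\<dots> \<approx> [(1, True), (2, True), (2, True), (1, True), (1, True), (2, False), (2, False), (1, False)]"
      using a[of "[(1, True), (2, True)]" "[(2, False), (1, False)]"] by simp
    also have "\<dots> \<approx> subst_word alpha_word [(2, True), (1, True), (2, False)]"
      by (rule braid_eq_by_reduce) auto
    finally show ?thesis .
  qed
qed

lemma alpha_product_conj_letter:
  assumes "alpha_product w"
  shows "alpha_product ([(2, e)] @ w @ [(2, \<not> e)])"
proof -
  have gen: "alpha_product ([(2, e)] @ alpha_word i @ [(2, \<not> e)])" if "i \<in> {1, 2}" for i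
  proof -
    have "alpha_product (alpha_word 1)" "alpha_product (alpha_word 2)"
      using alpha_product_subst[of "[(1, True)]"] alpha_product_subst[of "[(2, True)]"] by auto
    moreover have "alpha_product (subst_word alpha_word [(1, False), (2, True), (1, True)])"
      "alpha_product (subst_word alpha_word [(2, True), (1, True), (2, False)])"
      by (rule alpha_product_subst; simp)+
    ultimately show ?thesis
      using that alpha_product_cong[OF _ braid_eq_sym] conjugates_of_alpha
      by (cases e) (auto simp del: subst_word_simps)
  qed
  have letter: "alpha_product ([(2, e)] @ subst_word alpha_word [s] @ [(2, \<not> e)])"
    if "fst s \<in> {1, 2}" for s
    using gen[OF that] alpha_product_inv[OF gen[OF that]] by (cases s) auto
  have "alpha_product ([(2, e)] @ subst_word alpha_word u @ [(2, \<not> e)])" if "u \<in> words {1, 2}" for u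
    using that
  proof (induction u)
    case Nil
    have "[] \<approx> [(2, e), (2, \<not> e)]" by (rule braid_eq_by_reduce) auto
    then show ?case using alpha_product_cong alpha_product_subst[of "[]"] by auto
  next
    case (Cons s u)
    have s: "subst_word alpha_word [s] \<in> words {1..<3}" and u: "subst_word alpha_word u \<in> words {1..<3}"
      using Cons.prems by (intro subst_alpha_word_words; simp)+
    have "alpha_product (([(2, e)] @ subst_word alpha_word [s] @ [(2, \<not> e)]) @
        ([(2, e)] @ subst_word alpha_word u @ [(2, \<not> e)]))" (is "alpha_product ?w")
      using Cons.prems by (intro alpha_product_append[OF letter Cons.IH]) simp_all
    moreover have "?w \<approx> [(2, e)] @ (subst_word alpha_word [s] @ subst_word alpha_word u) @ [(2, \<not> e)]"
      using word_eq.cancel[of "[(2, e)] @ subst_word alpha_word [s]" "{1..<3}"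
          "subst_word alpha_word u @ [(2, \<not> e)]" 2 "braid_relations 3" "\<not> e"] s u
      by (simp add: braid_eq_def)
    moreover have "subst_word alpha_word [s] @ subst_word alpha_word u = subst_word alpha_word (s # u)"
      by (cases s) simp
    ultimately show ?case using alpha_product_cong by metis
  qed
  moreover obtain u where u: "u \<in> words {1, 2}" "subst_word alpha_word u \<approx> w"
    using assms unfolding alpha_product_def by blast
  moreover have "[(2, e)] @ subst_word alpha_word u @ [(2, \<not> e)] \<approx> [(2, e)] @ w @ [(2, \<not> e)]"
    by (intro braid_eq_append u braid_eq_refl) auto
  ultimately show ?thesis using alpha_product_cong by blast
qed

lemma alpha_product_conj:
  assumes "f \<in> words {2}" "alpha_product w"
  shows "alpha_product (f @ w @ inv_word f)"
  using assms(1)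
proof (induction f)
  case (Cons x f)
  obtain e where x: "x = (2, e)" using Cons.prems by (cases x) auto
  show ?case using alpha_product_conj_letter[of "f @ w @ inv_word f" e] Cons x by simp
qed (simp add: assms(2))

text \<open>
Coset representatives of the braids for which the stirrer ends where it starts: the braid
\<open>stirrer_to p\<close> moves the stirrer from position \<open>1\<close> to position \<open>p\<close>.
\<close>

definition stirrer_to :: "nat \<Rightarrow> nat word" where
  "stirrer_to p = (if p = 1 then [] else if p = 2 then [(1, True)] else [(1, True), (2, True)])"

lemma stirrer_to_simps [simp]:
  "stirrer_to 1 = []" "stirrer_to 2 = [(1, True)]"
  "stirrer_to 3 = [(1, True), (2, True)]"
  by (auto simp: stirrer_to_def)

lemma stirrer_to_words: "stirrer_to p \<in> words {1..<3}"
  by (simp add: stirrer_to_def)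

text \<open>
The inclusion of the braids on the two obstacles into those on three strings, with the stirrer
resting on the left.
\<close>

definition shift :: "nat word \<Rightarrow> nat word" where
  "shift = map (\<lambda>(i, b). (i + 1, b))"

lemma shift_simps [simp]:
  "shift [] = []" "shift ((i, b) # w) = (i + 1, b) # shift w" "shift (v @ w) = shift v @ shift w"
  by (simp_all add: shift_def)

lemma shift_words: "w \<in> words {1..<2} \<Longrightarrow> shift w \<in> words {2}"
  by (induction w) (auto simp: shift_def)

lemma words_2: "w \<in> words {2} \<Longrightarrow> w \<in> words {1..<3::nat}"
  by (auto simp: words_def)

text \<open>
A half twist either involves the stirrer, and then changes its position up to a generator
\<open>\<alpha>\<^sub>j\<close>, or only swaps the obstacles, and then passes to the left of the coset representative
as \<open>\<sigma>\<^sub>2\<close>.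
\<close>

lemma comb_letter:
  assumes "fst s \<in> {1, 2}" "p \<in> {1..3}"
  shows "\<exists>g. alpha_product g \<and>
    stirrer_to p @ [s] \<approx> g @ shift (fill_in p [s]) @ stirrer_to (braid_perm [s] p)"
proof -
  have prods: "alpha_product []" "alpha_product (alpha_word 1)" "alpha_product (alpha_word 2)"
    "alpha_product (inv_word (alpha_word 1))" "alpha_product (inv_word (alpha_word 2))"
    using alpha_product_subst[of "[]"] alpha_product_subst[of "[(1, True)]"] alpha_product_subst[of "[(2, True)]"]
      alpha_product_subst[of "[(1, False)]"] alpha_product_subst[of "[(2, False)]"] by auto
  obtain i e where s: "s = (i, e)" by (cases s)
  consider (a) "p = 1" "i = 1" | (b) "p = 1" "i = 2" | (c) "p = 2" "i = 1" | (d) "p = 2" "i = 2"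
    | (e) "p = 3" "i = 1" | (f) "p = 3" "i = 2"
    using assms s unfolding atLeastAtMost_1_3 by auto
  then show ?thesis
  proof cases
    case a
    show ?thesis
      by (rule exI[of _ "if e then [] else inv_word (alpha_word 1)"])
        (use a s prods in \<open>auto simp: transpose_def intro!: braid_eq_by_reduce\<close>)
  next
    case b
    show ?thesis
      by (rule exI[of _ "[]"]) (use b s prods in \<open>auto simp: transpose_def intro!: braid_eq_by_reduce\<close>)
  next
    case c
    show ?thesis
      by (rule exI[of _ "if e then alpha_word 1 else []"])
        (use c s prods in \<open>auto simp: transpose_def intro!: braid_eq_by_reduce\<close>)
  next
    case d
    show ?thesis
      by (rule exI[of _ "if e then [] else inv_word (alpha_word 2)"])
        (use d s prods in \<open>auto simp: transpose_def intro!: braid_eq_by_reduce\<close>)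
  next
    case e
    have "[(1, True), (2, True), (1, True)] \<approx> [(2, True), (1, True), (2, True)]"
      by (rule braid_eq_via_relation[of "[]" "[]"]) auto
    moreover have "[(1, True), (2, True), (1, False)] \<approx> [(2, False), (1, True), (2, True)]"
      by (rule braid_eq_sym, rule braid_eq_via_relation[of "[(2, False)]" "[(1, False)]"]) auto
    ultimately show ?thesis
      by (intro exI[of _ "[]"]) (use e s prods in \<open>cases \<open>snd s\<close>; auto simp: transpose_def \<close>)
  next
    case f
    show ?thesis
      by (rule exI[of _ "if e then alpha_word 2 else []"])
        (use f s prods in \<open>auto simp: transpose_def intro!: braid_eq_by_reduce\<close>)
  qed
qed

text \<open>
Combing: every braid factors into a protocol, a braid of the obstacles alone and a coset
representative. Letters are treated one at a time; each obstacle braid that arises is moved to the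
right past the next protocol, which is conjugated by it.
\<close>

lemma comb:
  assumes "w \<in> words {1..<3}" "p \<in> {1..3}"
  shows "\<exists>g. alpha_product g \<and>
    stirrer_to p @ w \<approx> g @ shift (fill_in p w) @ stirrer_to (braid_perm w p)"
  using assms
proof (induction w arbitrary: p)
  case Nil
  then show ?case
    using alpha_product_subst[of "[]"] braid_eq_refl[OF stirrer_to_words] by (intro exI[of _ "[]"]) auto
next
  case (Cons s w)
  define q where "q = braid_perm [s] p"
  define f where "f = shift (fill_in p [s])"
  define f' where "f' = shift (fill_in q w)"
  define t where "t = stirrer_to (braid_perm w q)"
  have w: "w \<in> words {1..<3}" and s: "fst s \<in> {1, 2}" using Cons.prems by auto
  have q: "q \<in> {1..3}" using braid_perm_range[of "[s]" 3 p] Cons.prems by (simp add: q_def)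
  have f2: "f \<in> words {2}" "f' \<in> words {2}"
    using fill_in_words[of "[s]" 3 p] fill_in_words[of w 3 q] Cons.prems q
    by (auto simp: f_def f'_def intro!: shift_words)
  note f3 = f2[THEN words_2]
  have t: "t \<in> words {1..<3}" by (simp add: t_def stirrer_to_words)
  obtain g where g: "alpha_product g" "stirrer_to p @ [s] \<approx> g @ f @ stirrer_to q"
    using comb_letter[OF s Cons.prems(2)] by (auto simp: f_def q_def)
  obtain h where h: "alpha_product h" "stirrer_to q @ w \<approx> h @ f' @ t"
    using Cons.IH[OF w q] by (auto simp: f'_def t_def)
  note g3 = alpha_product_words[OF g(1)] and h3 = alpha_product_words[OF h(1)]
  have split: "shift (fill_in p (s # w)) = f @ f'" "stirrer_to (braid_perm (s # w) p) = t"
    using fill_in_append[of p "[s]" w] braid_perm_append[of "[s]" w]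
    by (simp_all add: f_def f'_def t_def q_def)
  have "stirrer_to p @ (s # w) \<approx> (g @ f @ stirrer_to q) @ w"
    using braid_eq_append[OF g(2) braid_eq_refl[OF w]] by simp
  also have "(g @ f @ stirrer_to q) @ w = (g @ f) @ (stirrer_to q @ w)" by simp
  also have "\<dots> \<approx> (g @ f) @ (h @ f' @ t)"
    by (rule braid_eq_append[OF braid_eq_refl h(2)]) (use g3 f3 in simp)
  also have "\<dots> = (g @ f @ h) @ [] @ (f' @ t)" by simp
  also have "\<dots> \<approx> (g @ f @ h) @ (inv_word f @ f) @ (f' @ t)"
    using word_eq_inv_left[OF f3(1)] g3 h3 f3 t
    by (intro braid_eq_append braid_eq_refl) (auto simp: braid_eq_def intro: word_eq.sym)
  also have "\<dots> = (g @ f @ h @ inv_word f) @ (f @ f') @ t" by simp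
  finally have "stirrer_to p @ (s # w) \<approx> (g @ f @ h @ inv_word f) @ (f @ f') @ t" .
  moreover have "alpha_product (g @ f @ h @ inv_word f)"
    by (intro alpha_product_append alpha_product_conj g f2 h)
  ultimately show ?case unfolding split by blast
qed

lemma shift_trivial: "word_eq {1..<2} {} v w \<Longrightarrow> shift v \<approx> shift w"
proof (induction rule: word_eq.induct)
  case (refl w)
  then show ?case by (intro braid_eq_refl words_2 shift_words)
next
  case (cancel u v g b)
  have "shift u \<in> words {1..<3}" "shift v \<in> words {1..<3}"
    using cancel by (intro words_2 shift_words; simp)+
  then show ?case
    using cancel word_eq.cancel[of "shift u" "{1..<3}" "shift v" "g + 1" "braid_relations 3" b]
    by (simp add: braid_eq_def)
qed (auto intro: braid_eq_sym braid_eq_trans)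

text \<open>
For a pure braid the coset representative in its combed form is trivial, and filling in the stirrer
leaves only the braid of the obstacles. If that is trivial too, the protocol factor remains.
\<close>

lemma point_push_generated:
  assumes "\<chi> \<in> \<P>\<^sub>2"
  obtains u where "u \<in> words {1, 2}" "\<chi> = braid 3 (subst_word alpha_word u)"
proof -
  obtain w where w: "w \<in> words {1..<3}" and \<chi>: "\<chi> = braid 3 w"
    using assms by (auto simp: point_push_protocols_def pure_braids_def braid_group_simps)
  have perm: "braid_perm w = id" and fill: "braid 2 (fill_in 1 w) = braid 2 []"
    using assms in_point_push_iff[OF w] by (auto simp: \<chi> braid_group_simps)
  have fw: "fill_in 1 w \<in> words {1..<2}" using fill_in_words[OF w, of 1] by simp
  have "braid_relations 2 = {}" by (auto simp: braid_relations_def)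
  then have "word_eq {1..<2} {} (fill_in 1 w) []" using fill braid_eq_iff[OF fw] by simp
  then have triv: "shift (fill_in 1 w) \<approx> []" using shift_trivial by force
  obtain g where g: "alpha_product g" "w \<approx> g @ shift (fill_in 1 w)"
    using comb[OF w, of 1] perm by auto
  then obtain u where u: "u \<in> words {1, 2}" "subst_word alpha_word u \<approx> g"
    unfolding alpha_product_def by blast
  have "g @ shift (fill_in 1 w) \<approx> g @ []"
    by (intro braid_eq_append triv braid_eq_refl alpha_product_words g)
  then have "w \<approx> subst_word alpha_word u"
    using g(2) u(2) braid_eq_sym braid_eq_trans by (metis append_Nil2)
  then show ?thesis
    using that[OF u(1)] \<chi> braid_eq_iff[OF w] by (simp add: braid_eq_def)
qed

section \<open>Words in the loops around the obstacles\<close>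

definition delta_word :: "nat \<Rightarrow> nat word" where
  "delta_word i = (if i = 1 then [(2, True)] else if i = 2 then [(3, True)]
     else [(3, False), (2, False), (1, False)])"

text \<open>
The inverse change of basis: the loop around the puncture in position \<open>k\<close>, written in the
\<open>\<delta>\<^sub>i\<close>.
\<close>

definition puncture_word :: "nat \<Rightarrow> nat word" where
  "puncture_word k = (if k = 1 then [(3, False), (2, False), (1, False)]
     else if k = 2 then [(1, True)] else [(2, True)])"

lemma delta_word_simps [simp]:
  "delta_word 1 = [(2, True)]" "delta_word 2 = [(3, True)]"
  "delta_word 3 = [(3, False), (2, False), (1, False)]"
  by (auto simp: delta_word_def)

lemma puncture_word_simps [simp]:
  "puncture_word 1 = [(3, False), (2, False), (1, False)]"
  "puncture_word 2 = [(1, True)]" "puncture_word 3 = [(2, True)]"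
  by (auto simp: puncture_word_def)

lemma delta_word_words: "delta_word i \<in> words {1..3}"
  by (simp add: delta_word_def)

lemma subst_delta_word_words: "w \<in> words {1..3} \<Longrightarrow> subst_word delta_word w \<in> words {1..3}"
  by (rule subst_word_words) (auto intro: delta_word_words)

lemma subst_word_single: "subst_word (\<lambda>k. [(k, True)]) w = w"
  by (induction w) auto

lemma puncture_delta:
  assumes "w \<in> words {1..3}"
  shows "word_eq {1..3} {} (subst_word puncture_word (subst_word delta_word w)) w"
proof -
  have "word_eq {1..3} {} (subst_word puncture_word (delta_word k)) [(k, True)]" if "k \<in> {1..3}" for k
    using that unfolding atLeastAtMost_1_3 by (intro word_eq_by_reduce; elim insertE emptyE; simp)
  from word_eq_subst_cong[OF assms this, of "\<lambda>k. k"] show ?thesis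
    by (simp add: subst_word_subst_word subst_word_single)
qed

abbreviation delta_loop :: "nat word \<Rightarrow> nat word set" where
  "delta_loop w \<equiv> loop (subst_word delta_word w)"

abbreviation delta_length :: "nat word set \<Rightarrow> nat" where
  "delta_length \<equiv> word_length pi1 {\<delta>\<^sub>1, \<delta>\<^sub>2, \<delta>\<^sub>3}"

lemma deltas_eq: "{\<delta>\<^sub>1, \<delta>\<^sub>2, \<delta>\<^sub>3} = (\<lambda>i. delta_loop [(i, True)]) ` {1..3}"
  unfolding atLeastAtMost_1_3 by (simp add: \<delta>_eq_loop)

lemma delta_length_eq: "delta_length (delta_loop w) =
  (LEAST n. \<exists>v\<in>words {1..3}. length v = n \<and>
     word_eq {1..3} {} (subst_word delta_word v) (subst_word delta_word w))"
proof -
  have "{\<delta>\<^sub>1, \<delta>\<^sub>2, \<delta>\<^sub>3} = (\<lambda>i. word_class {1..3} {} (delta_word i)) ` {1..3}"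
    by (simp add: deltas_eq loop_def)
  then show ?thesis
    using word_length_presented_group[OF delta_word_words] by (simp add: pi1_def loop_def)
qed

lemma delta_length_le:
  assumes "w \<in> words {1..3}"
  shows "delta_length (delta_loop w) \<le> length w"
  unfolding delta_length_eq
  using assms subst_delta_word_words[OF assms] by (intro Least_le) (blast intro: word_eq.refl)

text \<open>
The \<open>\<delta>\<^sub>i\<close> are a free basis: changing back to them by \<open>puncture_word\<close> turns any word for the
same loop into a word that freely reduces to \<open>w\<close>, and reduction does not lengthen words.
\<close>

lemma delta_length_reduced:
  assumes "w \<in> words {1..3}" "reduced w"
  shows "delta_length (delta_loop w) = length w"
proof (rule antisym[OF delta_length_le[OF assms(1)]])
  let ?P = "\<lambda>n. \<exists>v\<in>words {1..3}. length v = n \<and>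
     word_eq {1..3} {} (subst_word delta_word v) (subst_word delta_word w)"
  have "?P (length w)"
    using assms subst_delta_word_words[OF assms(1)] by (blast intro: word_eq.refl)
  from LeastI[of ?P, OF this] obtain v where v: "v \<in> words {1..3}"
    "length v = delta_length (delta_loop w)"
    "word_eq {1..3} {} (subst_word delta_word v) (subst_word delta_word w)"
    unfolding delta_length_eq by blast
  have "puncture_word k \<in> words {1..3}" for k by (simp add: puncture_word_def)
  then have "word_eq {1..3} {} (subst_word puncture_word (subst_word delta_word v))
      (subst_word puncture_word (subst_word delta_word w))"
    by (intro word_eq_subst[OF v(3)])
  then have "word_eq {1..3} {} v w"
    using puncture_delta[OF v(1)] puncture_delta[OF assms(1)] by (meson word_eq.sym word_eq.trans)
  from length_reduced_le[OF this assms(2)] v(2) show "length w \<le> delta_length (delta_loop w)" by simp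
qed

text \<open>
To recognise the action of a braid as a substitution in the \<open>\<delta>\<^sub>i\<close>, it suffices to compare
reduced words for the images of the three basis loops.
\<close>

lemma induced_delta_loop:
  assumes "c \<in> words {1..<3}" "w \<in> words {1..3}"
    and f: "\<And>k. k \<in> {1..3} \<Longrightarrow> f k \<in> words {1..3}"
    and act: "\<And>k. k \<in> {1..3} \<Longrightarrow>
      foldr cancel_cons (braid_act c (delta_word k)) [] = foldr cancel_cons (subst_word delta_word (f k)) []"
  shows "induced (braid 3 c) (delta_loop w) = delta_loop (subst_word f w)"
proof -
  have dw: "subst_word delta_word w \<in> words {1..3}" by (rule subst_delta_word_words[OF assms(2)])
  have "braid_act c (subst_word delta_word w) =
      subst_word (\<lambda>j. subst_word (\<lambda>k. braid_act c [(k, True)]) (delta_word j)) w"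
    by (simp only: braid_act_eq_subst[of c "subst_word delta_word w"] subst_word_subst_word)
  also have "\<dots> = subst_word (\<lambda>j. braid_act c (delta_word j)) w"
    by (simp only: braid_act_eq_subst[symmetric])
  finally have "word_eq {1..3} {} (braid_act c (subst_word delta_word w))
      (subst_word (\<lambda>j. subst_word delta_word (f j)) w)"
    using assms(2) act braid_act_words[OF assms(1) delta_word_words] subst_delta_word_words[OF f]
    by (auto intro!: word_eq_subst_cong word_eq_by_reduce)
  then show ?thesis
    using braid_act_words[OF assms(1) dw]
    by (simp add: induced_braid_loop[OF assms(1) dw] loop_eq_iff subst_word_subst_word)
qed

lemma funpow_induced:
  assumes "w \<in> words {1..3}"
    and "\<And>v. v \<in> words {1..3} \<Longrightarrow> g v \<in> words {1..3} \<and> induced \<chi> (delta_loop v) = delta_loop (g v)"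
  shows "(g ^^ n) w \<in> words {1..3} \<and> (induced \<chi> ^^ n) (delta_loop w) = delta_loop ((g ^^ n) w)"
  using assms by (induction n) auto

section \<open>Growth under push maps: the upper bound\<close>

text \<open>
The action of \<open>\<alpha>\<^sub>i\<close> (for \<open>e\<close>) or of its inverse (for \<open>\<not> e\<close>) in the basis
\<open>\<delta>\<^sub>1, \<delta>\<^sub>2, \<delta>\<^sub>3\<close>.
\<close>

fun push :: "nat \<times> bool \<Rightarrow> nat \<Rightarrow> nat word" where
  "push (i, e) k =
    (if k = 1 \<and> i = 1 then
       (if e then [(3, False), (2, False), (1, True), (2, True), (3, True)]
        else [(2, True), (3, True), (1, True), (3, False), (2, False)])
     else if k = 2 \<and> i = 2 then
       (if e then [(1, False), (3, False), (2, True), (3, True), (1, True)]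
        else [(3, True), (1, True), (2, True), (1, False), (3, False)])
     else [(k, True)])"

lemma push_words: "k \<in> {1..3} \<Longrightarrow> push s k \<in> words {1..3}"
  by (cases s) auto

lemma subst_push_words: "w \<in> words {1..3} \<Longrightarrow> subst_word (push s) w \<in> words {1..3}"
  by (rule subst_word_words) (auto intro: push_words)

lemma fold_push_words: "w \<in> words {1..3} \<Longrightarrow> fold (\<lambda>s. subst_word (push s)) u w \<in> words {1..3}"
  by (induction u arbitrary: w) (auto intro: subst_push_words)

lemma induced_push_letter:
  assumes "fst s \<in> {1, 2}" "w \<in> words {1..3}"
  shows "induced (braid 3 (subst_word alpha_word [s])) (delta_loop w) = delta_loop (subst_word (push s) w)"
proof (rule induced_delta_loop[OF _ assms(2)])
  show "subst_word alpha_word [s] \<in> words {1..<3}"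
    using assms(1) by (intro subst_alpha_word_words) simp
  obtain i e where s: "s = (i, e)" by (cases s)
  show "push s k \<in> words {1..3}" if "k \<in> {1..3}" for k using that by (rule push_words)
  show "foldr cancel_cons (braid_act (subst_word alpha_word [s]) (delta_word k)) [] =
      foldr cancel_cons (subst_word delta_word (push s k)) []" if "k \<in> {1..3}" for k
    using that assms(1) unfolding s atLeastAtMost_1_3
    by (cases e; elim insertE emptyE; simp)
qed

lemma induced_push:
  assumes "u \<in> words {1, 2}" "w \<in> words {1..3}"
  shows "induced (braid 3 (subst_word alpha_word u)) (delta_loop w) =
    delta_loop (fold (\<lambda>s. subst_word (push s)) u w)"
  using assms
proof (induction u arbitrary: w)
  case Nil
  then show ?case using induced_braid_loop[of "[]"] subst_delta_word_words by simp
next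
  case (Cons s u)
  have s: "subst_word alpha_word [s] \<in> words {1..<3}" and u: "subst_word alpha_word u \<in> words {1..<3}"
    using Cons.prems by (intro subst_alpha_word_words; simp)+
  have "braid 3 (subst_word alpha_word (s # u)) =
      braid 3 (subst_word alpha_word [s]) \<otimes>\<^bsub>B3\<^esub> braid 3 (subst_word alpha_word u)"
    using s u by (cases s) (simp add: braid_group_simps)
  moreover have "delta_loop w \<in> carrier pi1"
    using Cons.prems subst_delta_word_words by (auto simp: pi1_simps)
  ultimately have "induced (braid 3 (subst_word alpha_word (s # u))) (delta_loop w) =
      induced (braid 3 (subst_word alpha_word u)) (induced (braid 3 (subst_word alpha_word [s])) (delta_loop w))"
    using s u induced_mult by (simp add: braid_group_simps(1))
  also have "\<dots> = induced (braid 3 (subst_word alpha_word u)) (delta_loop (subst_word (push s) w))"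
    using Cons.prems by (subst induced_push_letter) auto
  also have "\<dots> = delta_loop (fold (\<lambda>s. subst_word (push s)) u (subst_word (push s) w))"
    using Cons.prems by (intro Cons.IH subst_push_words) auto
  finally show ?case by simp
qed

definition letter_count :: "'g \<Rightarrow> 'g word \<Rightarrow> nat" where
  "letter_count k w = count_list (map fst w) k"

lemma letter_count_simps [simp]:
  "letter_count k [] = 0"
  "letter_count k (x # w) = (if fst x = k then 1 else 0) + letter_count k w"
  "letter_count k (v @ w) = letter_count k v + letter_count k w"
  by (auto simp: letter_count_def)

lemma letter_count_inv_word [simp]: "letter_count k (inv_word w) = letter_count k w"
  by (induction w) auto

lemma length_eq_letter_counts:
  "w \<in> words {1..3} \<Longrightarrow> length w = letter_count 1 w + letter_count 2 w + letter_count (3::nat) w"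
  unfolding atLeastAtMost_1_3 by (induction w) auto

lemma letter_count_subst:
  "w \<in> words {1..3} \<Longrightarrow> letter_count k (subst_word f w) =
    letter_count 1 w * letter_count k (f 1) + letter_count 2 w * letter_count k (f 2) +
    letter_count (3::nat) w * letter_count k (f 3)"
  unfolding atLeastAtMost_1_3 by (induction w) (auto simp: algebra_simps)

text \<open>
The operator norm of the shear is \<open>1 + sqrt 2\<close>: the largest eigenvalue of the shear times its
transpose is \<open>3 + 2 sqrt 2\<close>. The difference of the two sides is a nonnegative multiple of a square,
which vanishes on the eigenvector \<open>(1 + sqrt 2, 1)\<close>.
\<close>

lemma shear_norm:
  fixes a b :: real
  shows "a\<^sup>2 + (b + 2 * a)\<^sup>2 \<le> (1 + sqrt 2)\<^sup>2 * (a\<^sup>2 + b\<^sup>2)"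
proof -
  have "(1 + sqrt 2)\<^sup>2 * (a\<^sup>2 + b\<^sup>2) - (a\<^sup>2 + (b + 2 * a)\<^sup>2) =
      2 * (sqrt 2 - 1) * (a - (1 + sqrt 2) * b)\<^sup>2"
    by (simp add: power2_eq_square algebra_simps)
  moreover have "0 \<le> 2 * (sqrt 2 - 1) * (a - (1 + sqrt 2) * b)\<^sup>2" by simp
  ultimately show ?thesis by linarith
qed

text \<open>
The bound on the counts that \<open>N\<close> pushes can reach from a single letter. For \<open>\<delta>\<^sub>3\<close> the factor
\<open>2\<close> makes it inductive: each push adds at most \<open>2 (1 + sqrt 2) ^ N\<close> letters \<open>\<delta>\<^sub>3\<close>, and
\<open>2 + 2 \<le> 2 (1 + sqrt 2)\<close>.
\<close>

definition growth_bounded :: "nat \<Rightarrow> nat word \<Rightarrow> bool" where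
  "growth_bounded N w \<longleftrightarrow>
    (real (letter_count 1 w))\<^sup>2 + (real (letter_count 2 w))\<^sup>2 \<le> ((1 + sqrt 2) ^ N)\<^sup>2 \<and>
    real (letter_count 3 w) \<le> 2 * (1 + sqrt 2) ^ N"

lemma growth_bounded_le:
  assumes "growth_bounded N w"
  shows "real (letter_count 1 w) \<le> (1 + sqrt 2) ^ N" "real (letter_count 2 w) \<le> (1 + sqrt 2) ^ N"
    "real (letter_count 3 w) \<le> 2 * (1 + sqrt 2) ^ N"
proof -
  have "(real (letter_count 1 w))\<^sup>2 \<le> ((1 + sqrt 2) ^ N)\<^sup>2"
    "(real (letter_count 2 w))\<^sup>2 \<le> ((1 + sqrt 2) ^ N)\<^sup>2"
    using assms zero_le_power2[of "real (letter_count 1 w)"] zero_le_power2[of "real (letter_count 2 w)"]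
    unfolding growth_bounded_def by linarith+
  then show "real (letter_count 1 w) \<le> (1 + sqrt 2) ^ N" "real (letter_count 2 w) \<le> (1 + sqrt 2) ^ N"
    by (auto intro: power2_le_imp_le)
  show "real (letter_count 3 w) \<le> 2 * (1 + sqrt 2) ^ N"
    using assms unfolding growth_bounded_def by simp
qed

lemma growth_bounded_push:
  assumes "growth_bounded N w" "fst s \<in> {1, 2}" "w \<in> words {1..3}"
  shows "growth_bounded (Suc N) (subst_word (push s) w)"
proof -
  define a b c where "a = real (letter_count 1 w)" and "b = real (letter_count 2 w)"
    and "c = real (letter_count 3 w)"
  define v where "v = subst_word (push s) w"
  let ?l = "1 + sqrt (2::real)"
  note bnd = growth_bounded_le[OF assms(1), folded a_def b_def c_def]
  have sq: "a\<^sup>2 + b\<^sup>2 \<le> (?l ^ N)\<^sup>2" using assms(1) by (simp add: growth_bounded_def a_def b_def)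
  have step: "?l\<^sup>2 * (a\<^sup>2 + b\<^sup>2) \<le> (?l ^ Suc N)\<^sup>2"
    using mult_left_mono[OF sq, of "?l\<^sup>2"] by (simp add: power_mult_distrib)
  have "2 * ?l ^ N \<le> ?l * ?l ^ N" by (intro mult_right_mono) auto
  then have "2 * ?l ^ N + 2 * ?l ^ N \<le> 2 * ?l ^ Suc N" by simp
  then have third: "c + 2 * a \<le> 2 * ?l ^ Suc N" "c + 2 * b \<le> 2 * ?l ^ Suc N" using bnd by linarith+
  obtain i e where s: "s = (i, e)" by (cases s)
  from assms(2) consider "i = 1" | "i = 2" using s by auto
  then show ?thesis
  proof cases
    case 1
    have "real (letter_count 1 v) = a" "real (letter_count 2 v) = b + 2 * a"
      "real (letter_count 3 v) = c + 2 * a"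
      by (cases e; simp add: 1 s v_def letter_count_subst[OF assms(3)] a_def b_def c_def)+
    then show ?thesis using shear_norm[of a b] step third
      by (simp add: growth_bounded_def flip: v_def)
  next
    case 2
    have "real (letter_count 1 v) = a + 2 * b" "real (letter_count 2 v) = b"
      "real (letter_count 3 v) = c + 2 * b"
      by (cases e; simp add: 2 s v_def letter_count_subst[OF assms(3)] a_def b_def c_def)+
    then show ?thesis using shear_norm[of b a] step third
      by (simp add: growth_bounded_def add.commute flip: v_def)
  qed
qed

lemma growth_bounded_fold_push:
  "growth_bounded N w \<Longrightarrow> u \<in> words {1, 2} \<Longrightarrow> w \<in> words {1..3} \<Longrightarrow>
    growth_bounded (N + length u) (fold (\<lambda>s. subst_word (push s)) u w)"
proof (induction u arbitrary: w N)
  case (Cons s u)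
  have "growth_bounded (Suc N) (subst_word (push s) w)"
    using Cons.prems by (intro growth_bounded_push) auto
  from Cons.IH[OF this] show ?case using Cons.prems subst_push_words by simp
qed simp

lemma delta_length_growth_le:
  assumes "u \<in> words {1, 2}" "i \<in> {1..3}"
  shows "real (delta_length ((induced (braid 3 (subst_word alpha_word u)) ^^ n) (delta_loop [(i, True)])))
    \<le> 4 * (1 + sqrt 2) ^ (n * length u)"
proof -
  define g where "g = fold (\<lambda>s. subst_word (push s)) u"
  define w where "w = (g ^^ n) [(i, True)]"
  have i: "[(i, True)] \<in> words {1..3}" using assms(2) by simp
  have w: "w \<in> words {1..3}"
    and "(induced (braid 3 (subst_word alpha_word u)) ^^ n) (delta_loop [(i, True)]) = delta_loop w"
    using funpow_induced[OF i, of g "braid 3 (subst_word alpha_word u)" n]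
      fold_push_words induced_push[OF assms(1)] by (auto simp: g_def w_def)
  moreover have "growth_bounded (n * length u) w \<and> w \<in> words {1..3}"
    unfolding w_def
  proof (induction n)
    case 0
    show ?case using assms(2) unfolding atLeastAtMost_1_3 growth_bounded_def by auto
  next
    case (Suc n)
    then show ?case
      using growth_bounded_fold_push[OF _ assms(1), of "n * length u" "(g ^^ n) [(i, True)]"]
        fold_push_words by (simp add: g_def add.commute)
  qed
  then have "real (length w) \<le> 4 * (1 + sqrt 2) ^ (n * length u)"
    using growth_bounded_le[of "n * length u" w] by (simp add: length_eq_letter_counts[OF w])
  ultimately show ?thesis using delta_length_le[OF w] by simp
qed

section \<open>The protocol without cancellation\<close>

text \<open>
The action of \<open>\<alpha>\<^sub>1 \<alpha>\<^sub>2\<^sup>-\<^sup>1\<close> with images in reduced form. Composing the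
substitutions \<open>push\<close> gives \<open>\<delta>\<^sub>3\<^sup>-\<^sup>1 \<delta>\<^sub>3\<close> inside the image of \<open>\<delta>\<^sub>1\<close>, twice;
its count of \<open>\<delta>\<^sub>3\<close> is therefore lower here, but those of \<open>\<delta>\<^sub>1\<close> and \<open>\<delta>\<^sub>2\<close> are
the same.
\<close>

fun beta :: "nat \<Rightarrow> nat word" where
  "beta k =
    (if k = 1 then [(1, True), (2, False), (1, False), (3, False), (1, True), (3, True), (1, True),
       (2, True), (1, False)]
     else if k = 2 then [(3, True), (1, True), (2, True), (1, False), (3, False)]
     else [(k, True)])"

abbreviation beta_word :: "nat word" where
  "beta_word \<equiv> [(1, True), (2, False)]"

lemma beta_words: "k \<in> {1..3} \<Longrightarrow> beta k \<in> words {1..3}"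
  by auto

lemma subst_beta_words: "w \<in> words {1..3} \<Longrightarrow> subst_word beta w \<in> words {1..3}"
  by (rule subst_word_words) (auto intro: beta_words)

lemma induced_beta:
  assumes "w \<in> words {1..3}"
  shows "induced (braid 3 (subst_word alpha_word beta_word)) (delta_loop w) = delta_loop (subst_word beta w)"
proof (rule induced_delta_loop[OF _ assms])
  show "subst_word alpha_word beta_word \<in> words {1..<3}" by (rule subst_alpha_word_words) simp
  show "beta k \<in> words {1..3}" if "k \<in> {1..3}" for k using that by (rule beta_words)
  show "foldr cancel_cons (braid_act (subst_word alpha_word beta_word) (delta_word k)) [] =
      foldr cancel_cons (subst_word delta_word (beta k)) []" if "k \<in> {1..3}" for k
    using that unfolding atLeastAtMost_1_3 by (elim insertE emptyE; simp)
qed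

text \<open>
The pairs that may be adjacent in iterates, like the legal turns of a train track map.
\<close>

definition legal :: "nat \<times> bool \<Rightarrow> nat \<times> bool \<Rightarrow> bool" where
  "legal x y \<longleftrightarrow> \<not> mutually_inverse (last (subst_word beta [x])) (hd (subst_word beta [y]))"

text \<open>
The images of inverse letters are inverse words, so they cancel where they meet.
\<close>

lemma legal_imp_reduced:
  assumes "fst x \<in> {1..3}" "legal x y"
  shows "\<not> mutually_inverse x y"
proof
  assume "mutually_inverse x y"
  then obtain k b where "x = (k, b)" "y = (k, \<not> b)"
    by (cases x; cases y) (auto simp: mutually_inverse_def)
  then show False
    using assms unfolding atLeastAtMost_1_3
    by (cases b) (auto simp: legal_def mutually_inverse_def)
qed

text \<open>
The letters where the images of an allowed pair meet are again an allowed pair, and so are all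
adjacent letters within the images. Both are finite checks.
\<close>

lemma legal_beta:
  assumes "w \<in> words {1..3}" "successively legal w"
  shows "successively legal (subst_word beta w)"
  using assms
proof (rule successively_subst_word)
  fix x :: "nat \<times> bool" assume "fst x \<in> {1..3}"
  then show "subst_word beta [x] \<noteq> [] \<and> successively legal (subst_word beta [x])"
    unfolding atLeastAtMost_1_3
    by (cases x; cases "snd x") (auto simp: legal_def mutually_inverse_def)
next
  fix x y :: "nat \<times> bool" assume "fst x \<in> {1..3}" "fst y \<in> {1..3}" "legal x y"
  then show "legal (last (subst_word beta [x])) (hd (subst_word beta [y]))"
    unfolding atLeastAtMost_1_3
    by (cases x; cases y; cases "snd x"; cases "snd y") (auto simp: legal_def mutually_inverse_def)
qed

lemma legal_word_reduced:
  assumes "w \<in> words {1..3}" "successively legal w"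
  shows "reduced w"
  using assms
proof (induction w)
  case (Cons x w)
  then show ?case using legal_imp_reduced[of x "hd w"] by (auto simp: successively_Cons)
qed simp

text \<open>
\<open>(1, sqrt 2 - 1)\<close> is a left eigenvector of the matrix of letter counts, with eigenvalue
\<open>3 + 2 sqrt 2\<close>.
\<close>

lemma beta_growth:
  assumes "w \<in> words {1..3}"
  shows "real (letter_count 1 (subst_word beta w)) + (sqrt 2 - 1) * real (letter_count 2 (subst_word beta w)) =
    (3 + 2 * sqrt 2) * (real (letter_count 1 w) + (sqrt 2 - 1) * real (letter_count 2 w))"
  by (simp add: letter_count_subst[OF assms] algebra_simps)

lemma delta_length_beta_ge:
  "(3 + 2 * sqrt 2) ^ n \<le>
    real (delta_length ((induced (braid 3 (subst_word alpha_word beta_word)) ^^ n) \<delta>\<^sub>1))"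
proof -
  define w where "w n = (subst_word beta ^^ n) [(1, True)]" for n
  have words: "w n \<in> words {1..3}"
    and eq: "(induced (braid 3 (subst_word alpha_word beta_word)) ^^ n) \<delta>\<^sub>1 = delta_loop (w n)" for n
    using funpow_induced[of "[(1, True)]" "subst_word beta" "braid 3 (subst_word alpha_word beta_word)" n]
      induced_beta subst_beta_words by (auto simp: w_def \<delta>_eq_loop)
  have step: "w (Suc n) = subst_word beta (w n)" for n by (simp add: w_def)
  have "successively legal (w n)" for n
  proof (induction n)
    case 0
    show ?case by (simp add: w_def)
  next
    case (Suc n)
    then show ?case unfolding step by (rule legal_beta[OF words])
  qed
  then have "delta_length (delta_loop (w n)) = length (w n)" for n
    using delta_length_reduced[OF words] legal_word_reduced[OF words] by blast
  moreover have "real (letter_count 1 (w n)) + (sqrt 2 - 1) * real (letter_count 2 (w n)) =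
      (3 + 2 * sqrt 2) ^ n" for n
    by (induction n) (simp_all add: step beta_growth[OF words] w_def[of 0])
  \<comment> \<open>Both weights are at most \<open>1\<close>, so the weighted count is a lower bound for the length.\<close>
  moreover have "(sqrt 2 - 1) * real m \<le> 1 * real m" for m
    by (rule mult_right_mono) (use sqrt2_less_2 in auto)
  ultimately show ?thesis
    unfolding eq using length_eq_letter_counts[OF words, of n] by (smt (verit) of_nat_add of_nat_0_le_iff)
qed

section \<open>The maximal efficiency\<close>

abbreviation alpha_length :: "nat word set \<Rightarrow> nat" where
  "alpha_length \<equiv> word_length B3 {\<alpha>\<^sub>1, \<alpha>\<^sub>2}"

lemma alpha_length_eq: "alpha_length (braid 3 v) =
  (LEAST n. \<exists>u\<in>words {1, 2}. length u = n \<and> subst_word alpha_word u \<approx> v)"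
proof -
  have "{\<alpha>\<^sub>1, \<alpha>\<^sub>2} = (\<lambda>i. word_class {1..<3} (braid_relations 3) (alpha_word i)) ` {1, 2}"
    by (simp add: \<alpha>_eq_braid braid_def)
  then show ?thesis
    unfolding braid_eq_def braid_group_def braid_def
    by (simp only:) (rule word_length_presented_group[OF alpha_word_words])
qed

lemma alpha_length_le:
  assumes "u \<in> words {1, 2}"
  shows "alpha_length (braid 3 (subst_word alpha_word u)) \<le> length u"
  unfolding alpha_length_eq
  using assms braid_eq_refl[OF subst_alpha_word_words[OF assms]] by (intro Least_le) blast

text \<open>
\<open>LEAST\<close> picks out a length that is attained, because the \<open>\<alpha>\<^sub>j\<close> generate.
\<close>

lemma shortest_alpha_word:
  assumes "\<chi> \<in> \<P>\<^sub>2"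
  obtains u where "u \<in> words {1, 2}" "\<chi> = braid 3 (subst_word alpha_word u)" "length u = alpha_length \<chi>"
proof -
  obtain v where v: "v \<in> words {1, 2}" "\<chi> = braid 3 (subst_word alpha_word v)"
    using point_push_generated[OF assms] .
  let ?P = "\<lambda>n. \<exists>u\<in>words {1, 2}. length u = n \<and> subst_word alpha_word u \<approx> subst_word alpha_word v"
  have "?P (length v)"
    using v(1) braid_eq_refl[OF subst_alpha_word_words[OF v(1)]] by blast
  from LeastI[of ?P, OF this] obtain u where u: "u \<in> words {1, 2}" "length u = alpha_length \<chi>"
    "subst_word alpha_word u \<approx> subst_word alpha_word v"
    unfolding v(2) alpha_length_eq by blast
  moreover have "braid 3 (subst_word alpha_word u) = \<chi>"
    using u(3) v(2) subst_alpha_word_words[OF u(1)] by (simp add: braid_eq_iff braid_eq_def)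
  ultimately show ?thesis using that by metis
qed

lemma alpha_length_pos:
  assumes "\<chi> \<in> \<P>\<^sub>2 - {\<one>\<^bsub>B3\<^esub>}"
  shows "alpha_length \<chi> > 0"
proof -
  obtain u where "\<chi> = braid 3 (subst_word alpha_word u)" "length u = alpha_length \<chi>"
    using assms shortest_alpha_word by blast
  then show ?thesis using assms by (cases u) (auto simp: braid_group_simps)
qed

lemma limsup_log_le:
  fixes f :: "nat \<Rightarrow> real"
  assumes "\<And>n. f n \<le> a * c ^ n" "a \<ge> 1" "c \<ge> 1" "\<And>n. f n \<ge> 0"
  shows "limsup (\<lambda>n. ereal (ln (f n) / real n)) \<le> ereal (ln c)"
proof -
  have bnd: "ln (f n) / real n \<le> ln a / real n + ln c" if "n > 0" for n
  proof -
    have "ln (f n) \<le> ln (a * c ^ n)"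
    proof (cases "f n = 0")
      case True
      have "1 \<le> a * c ^ n" using assms(2) one_le_power[OF assms(3), of n] mult_mono[of 1 a 1 "c ^ n"] by simp
      then show ?thesis using True by simp
    next
      case False
      then show ?thesis using assms(1)[of n] assms(4)[of n] by (intro ln_mono) auto
    qed
    also have "\<dots> = ln a + real n * ln c"
      using assms(2,3) by (simp add: ln_mult ln_realpow)
    finally show ?thesis using that by (simp add: field_simps)
  qed
  have "(\<lambda>n. ln a / real n + ln c) \<longlonglongrightarrow> 0 + ln c"
    by (intro tendsto_add tendsto_const lim_const_over_n)
  then have "limsup (\<lambda>n. ereal (ln a / real n + ln c)) = ereal (ln c)"
    by (intro lim_imp_Limsup) auto
  moreover have "limsup (\<lambda>n. ereal (ln (f n) / real n)) \<le> limsup (\<lambda>n. ereal (ln a / real n + ln c))"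
    by (intro Limsup_mono eventually_mono[OF eventually_gt_at_top[of 0]]) (simp add: bnd)
  ultimately show ?thesis by simp
qed

lemma limsup_log_ge:
  fixes f :: "nat \<Rightarrow> real"
  assumes "\<And>n. c ^ n \<le> f n" "c > 0"
  shows "ereal (ln c) \<le> limsup (\<lambda>n. ereal (ln (f n) / real n))"
proof -
  have bnd: "ln c \<le> ln (f n) / real n" if "n > 0" for n
  proof -
    have "real n * ln c = ln (c ^ n)" using assms(2) by (simp add: ln_realpow)
    also have "\<dots> \<le> ln (f n)" by (rule ln_mono) (use assms in auto)
    finally show ?thesis using that by (simp add: field_simps)
  qed
  have "ereal (ln c) = limsup (\<lambda>n::nat. ereal (ln c))" by (simp add: Limsup_const)
  also have "\<dots> \<le> limsup (\<lambda>n. ereal (ln (f n) / real n))"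
    by (intro Limsup_mono eventually_mono[OF eventually_gt_at_top[of 0]]) (simp add: bnd)
  finally show ?thesis .
qed

lemma entropy_le:
  assumes "u \<in> words {1, 2}"
  shows "entropy pi1 {\<delta>\<^sub>1, \<delta>\<^sub>2, \<delta>\<^sub>3} (induced (braid 3 (subst_word alpha_word u))) \<le>
    ereal (real (length u) * ln (1 + sqrt 2))"
proof -
  have "limsup (\<lambda>n. ereal (ln (real (delta_length ((induced (braid 3 (subst_word alpha_word u)) ^^ n) x))) / real n))
      \<le> ereal (real (length u) * ln (1 + sqrt 2))" if "x \<in> {\<delta>\<^sub>1, \<delta>\<^sub>2, \<delta>\<^sub>3}" for x
  proof -
    obtain i where i: "i \<in> {1..3}" "x = delta_loop [(i, True)]" using \<open>x \<in> _\<close> unfolding deltas_eq by blast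
    have "real (delta_length ((induced (braid 3 (subst_word alpha_word u)) ^^ n) x))
        \<le> 4 * ((1 + sqrt 2) ^ length u) ^ n" for n
      using delta_length_growth_le[OF assms i(1), of n] by (simp add: i(2) power_mult mult.commute flip: power_mult)
    then have "limsup (\<lambda>n. ereal (ln (real (delta_length
        ((induced (braid 3 (subst_word alpha_word u)) ^^ n) x))) / real n))
        \<le> ereal (ln ((1 + sqrt 2) ^ length u))"
      by (rule limsup_log_le) auto
    also have "ln ((1 + sqrt 2) ^ length u) = real (length u) * ln (1 + sqrt 2)"
      by (rule ln_realpow)
    finally show ?thesis .
  qed
  then show ?thesis unfolding entropy_def by (intro Max.boundedI) auto
qed

lemma ln_silver_ratio: "ln (3 + 2 * sqrt 2) / 2 = ln (1 + sqrt 2)"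
proof -
  have "3 + 2 * sqrt 2 = (1 + sqrt 2) ^ 2" by (simp add: power2_eq_square algebra_simps)
  then have "ln (3 + 2 * sqrt 2) = real 2 * ln (1 + sqrt 2)"
    by (simp add: ln_realpow)
  then show ?thesis by simp
qed

lemma eff_le:
  assumes "\<chi> \<in> \<P>\<^sub>2 - {\<one>\<^bsub>B3\<^esub>}"
  shows "eff \<chi> \<le> ereal (ln (1 + sqrt 2))"
proof -
  obtain u where u: "u \<in> words {1, 2}" "\<chi> = braid 3 (subst_word alpha_word u)" "length u = alpha_length \<chi>"
    using assms shortest_alpha_word by blast
  show ?thesis
    using entropy_le[OF u(1)] alpha_length_pos[OF assms] u(2,3)
    by (simp add: eff_def ereal_divide_le_pos mult.commute)
qed

theorem theorem4p7:
  shows "\<alpha>\<^sub>1 \<otimes>\<^bsub>B3\<^esub> inv\<^bsub>B3\<^esub> \<alpha>\<^sub>2 \<in> \<P>\<^sub>2 - {\<one>\<^bsub>B3\<^esub>}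
    \<and> Eff2 = eff (\<alpha>\<^sub>1 \<otimes>\<^bsub>B3\<^esub> inv\<^bsub>B3\<^esub> \<alpha>\<^sub>2)
    \<and> Eff2 = ereal (ln (3 + 2 * sqrt 2) / 2)
    \<and> ln (3 + 2 * sqrt 2) / 2 = ln (1 + sqrt 2)"
proof -
  interpret P2: subgroup "\<P>\<^sub>2" B3 by (rule subgroup_point_push)
  define \<beta> where "\<beta> = \<alpha>\<^sub>1 \<otimes>\<^bsub>B3\<^esub> inv\<^bsub>B3\<^esub> \<alpha>\<^sub>2"
  have \<beta>: "\<beta> = braid 3 (subst_word alpha_word beta_word)"
    by (simp add: \<beta>_def \<alpha>_eq_braid braid_group_simps)
  have growth: "(3 + 2 * sqrt 2) ^ n \<le> real (delta_length ((induced \<beta> ^^ n) \<delta>\<^sub>1))" for n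
    using delta_length_beta_ge by (simp add: \<beta>)
  have "\<beta> \<noteq> \<one>\<^bsub>B3\<^esub>"
  proof
    assume "\<beta> = \<one>\<^bsub>B3\<^esub>"
    then have "induced \<beta> \<delta>\<^sub>1 = \<delta>\<^sub>1"
      by (simp add: braid_group_simps \<delta>_eq_loop induced_braid_loop)
    moreover have "delta_length \<delta>\<^sub>1 \<le> 1"
      using delta_length_le[of "[(1, True)]"] by (simp add: \<delta>_eq_loop)
    moreover have "3 + 2 * sqrt 2 > 1" using real_sqrt_gt_zero[of 2] by linarith
    ultimately show False using growth[of 1] by (simp add: One_nat_def)
  qed
  then have mem: "\<beta> \<in> \<P>\<^sub>2 - {\<one>\<^bsub>B3\<^esub>}"
    using \<alpha>_in_point_push by (simp add: \<beta>_def P2.m_closed P2.m_inv_closed group_braid_group)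
  have len: "0 < alpha_length \<beta>" "alpha_length \<beta> \<le> 2"
    using alpha_length_pos[OF mem] alpha_length_le[of beta_word] by (simp_all add: \<beta>)
  have "ereal (ln (3 + 2 * sqrt 2)) \<le>
      limsup (\<lambda>n. ereal (ln (real (delta_length ((induced \<beta> ^^ n) \<delta>\<^sub>1))) / real n))"
    by (rule limsup_log_ge[OF growth]) (simp add: add_pos_pos)
  also have "\<dots> \<le> entropy pi1 {\<delta>\<^sub>1, \<delta>\<^sub>2, \<delta>\<^sub>3} (induced \<beta>)"
    unfolding entropy_def by (rule Max_ge) auto
  finally have "ereal (2 * ln (1 + sqrt 2)) \<le> entropy pi1 {\<delta>\<^sub>1, \<delta>\<^sub>2, \<delta>\<^sub>3} (induced \<beta>)"
    by (simp flip: ln_silver_ratio)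
  moreover have "real (alpha_length \<beta>) * ln (1 + sqrt 2) \<le> 2 * ln (1 + sqrt 2)"
    using len(2) by (intro mult_right_mono) auto
  ultimately have "ereal (real (alpha_length \<beta>) * ln (1 + sqrt 2)) \<le>
      entropy pi1 {\<delta>\<^sub>1, \<delta>\<^sub>2, \<delta>\<^sub>3} (induced \<beta>)"
    using ereal_less_eq(3) order_trans by blast
  then have "ereal (ln (1 + sqrt 2)) \<le> eff \<beta>"
    using len(1) by (simp add: eff_def ereal_le_divide_pos mult.commute)
  then have "eff \<beta> = ereal (ln (1 + sqrt 2))" using eff_le[OF mem] by (rule antisym[rotated])
  moreover have "Eff2 = ereal (ln (1 + sqrt 2))"
    unfolding Eff2_def
  proof (rule SUP_eqI)
    show "ereal (ln (1 + sqrt 2)) \<le> y" if "\<And>\<chi>. \<chi> \<in> \<P>\<^sub>2 - {\<one>\<^bsub>B3\<^esub>} \<Longrightarrow> eff \<chi> \<le> y" for y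
      using that[OF mem] \<open>eff \<beta> = _\<close> by simp
  qed (rule eff_le)
  ultimately show ?thesis
    using mem ln_silver_ratio unfolding \<beta>_def by simp
qed

end
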